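(* Let $f:\mathbb{R}\to\mathbb{R}$ be a linear combination of convex functions, with left derivative $f'_-$. Let $X\in\mathcal{X}^{\alpha}$ for some $\alpha\in(0,1)$ with $\alpha>\frac13$, let $0<\beta<\alpha\wedge(3\alpha-1)$, and let $Y=(Y_t)_{t\in[0,T]}$ be a process with $Y\in W_1^{1-\beta}$ (almost surely). Then the integral $$\int_0^T f'_-(X_u)\,dY_u$$ exists almost surely in the sense of the generalized Lebesgue--Stieltjes integral.
   Context: Fix $T>0$. Fractional Besov spaces on $[0,T]$, for $0<\beta<1$: $W_1^\beta$ is the space of measurable $h:[0,T]\to\mathbb{R}$ with $$\|h\|_{1,\beta}=\sup_{0\le s<t\le T}\left(\frac{|h(t)-h(s)|}{(t-s)^\beta}+\int_s^t\frac{|h(u)-h(s)|}{(u-s)^{1+\beta}}\,du\right)<\infty,$$ and $W_2^\beta$ is the space of measurable $h$ with $$\|h\|_{2,\beta}=\int_0^T\frac{|h(s)|}{s^\beta}\,ds+\int_0^T\int_0^s\frac{|h(u)-h(s)|}{(s-u)^{1+\beta}}\,du\,ds<\infty .$$ Generalized Lebesgue--Stieltjes integral: for $h\in W_2^\beta$ and $g\in W_1^{1-\beta}$ and $t\in(0,T]$, it is the Lebesgue integral $$\int_0^t h(s)\,dg(s)=(-1)^\beta\int_0^t (D^\beta_{0+}h)(s)\,(D^{1-\beta}_{t-}g_{t-})(s)\,ds,\qquad g_{t-}(s)=g(s)-g(t-),$$ where $(-1)^\beta=e^{i\pi\beta}$ and $$(D^\beta_{0+}h)(s)=\frac{1}{\Gamma(1-\beta)}\left(\frac{h(s)}{s^\beta}+\beta\int_0^s\frac{h(s)-h(u)}{(s-u)^{\beta+1}}\,du\right),$$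 $$(D^\beta_{t-}h)(s)=\frac{(-1)^{\beta}}{\Gamma(1-\beta)}\left(\frac{h(s)}{(t-s)^\beta}+\beta\int_s^t\frac{h(s)-h(u)}{(u-s)^{\beta+1}}\,du\right).$$ For stochastic processes the integral is taken path by path. Class $\mathcal{X}^\alpha$: for a centered Gaussian process $X=(X_t)_{t\in[0,T]}$ put $R(t,s)=\mathbb{E}[X_tX_s]$, $W(t,s)=\mathbb{E}[(X_t-X_s)^2]$, $V(t)=\mathbb{E}[X_t^2]$ and $w^*(t)=\sup_{0\le s\le T-t}W(t+s,s)$. For $0<\alpha<1$, a centered continuous Gaussian process $X$ on $[0,T]$ belongs to $\mathcal{X}^\alpha$ if (i) $R(s,t)>0$ for all $s,t>0$; (ii) $w^*(t)=Ct^{2\alpha}+o(t^{2\alpha})$ as $t\to0$, for some $C>0$; (iii) there exist $c,\delta>0$ such that $V(s)\ge cs^2$ for $s\le\delta$; (iv) there exists $\delta>0$ such that $\sup_{0<t<2\delta}\sup_{t/2\le s\le t}\frac{R(s,s)}{R(t,s)}<\infty$. *)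

theory Defs
  imports "HOL-Probability.Probability" "HOL-Library.Landau_Symbols"
begin

text \<open>
  Functions and processes on $[0,T]$ are represented by total functions on the reals; only their
  values on $[0,T]$ enter the definitions below.
\<close>

text \<open>The norms take values in $[0,\infty]$, so that finiteness is a genuine condition.\<close>

definition besov1_norm :: "real \<Rightarrow> real \<Rightarrow> (real \<Rightarrow> real) \<Rightarrow> ennreal" where
  "besov1_norm T \<beta> h =
     (SUP (s, t) \<in> {(s, t). 0 \<le> s \<and> s < t \<and> t \<le> T}.
        ennreal (\<bar>h t - h s\<bar> / (t - s) powr \<beta>) +
        (\<integral>\<^sup>+u\<in>{s<..<t}. ennreal (\<bar>h u - h s\<bar> / (u - s) powr (1 + \<beta>)) \<partial>lborel))"

definition besov2_norm :: "real \<Rightarrow> real \<Rightarrow> (real \<Rightarrow> real) \<Rightarrow> ennreal" where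
  "besov2_norm T \<beta> h =
     (\<integral>\<^sup>+s\<in>{0<..<T}. ennreal (\<bar>h s\<bar> / s powr \<beta>) \<partial>lborel) +
     (\<integral>\<^sup>+s\<in>{0<..<T}.
        (\<integral>\<^sup>+u\<in>{0<..<s}. ennreal (\<bar>h u - h s\<bar> / (s - u) powr (1 + \<beta>)) \<partial>lborel) \<partial>lborel)"

definition besov1 :: "real \<Rightarrow> real \<Rightarrow> (real \<Rightarrow> real) set" where
  "besov1 T \<beta> = {h. h \<in> borel_measurable (restrict_space borel {0..T}) \<and> besov1_norm T \<beta> h < \<infinity>}"

definition besov2 :: "real \<Rightarrow> real \<Rightarrow> (real \<Rightarrow> real) set" where
  "besov2 T \<beta> = {h. h \<in> borel_measurable (restrict_space borel {0..T}) \<and> besov2_norm T \<beta> h < \<infinity>}"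

definition minus_one_powr :: "real \<Rightarrow> complex" where
  "minus_one_powr \<beta> = exp (\<i> * of_real (pi * \<beta>))"

definition frac_deriv_left :: "real \<Rightarrow> (real \<Rightarrow> real) \<Rightarrow> real \<Rightarrow> real" where
  "frac_deriv_left \<beta> h s =
     1 / Gamma (1 - \<beta>) *
       (h s / s powr \<beta> + \<beta> * (LBINT u:{0<..<s}. (h s - h u) / (s - u) powr (\<beta> + 1)))"

definition frac_deriv_right :: "real \<Rightarrow> real \<Rightarrow> (real \<Rightarrow> real) \<Rightarrow> real \<Rightarrow> complex" where
  "frac_deriv_right \<beta> t h s =
     minus_one_powr \<beta> / of_real (Gamma (1 - \<beta>)) *
       of_real (h s / (t - s) powr \<beta> + \<beta> * (LBINT u:{s<..<t}. (h s - h u) / (u - s) powr (\<beta> + 1)))"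

definition minus_left_limit :: "(real \<Rightarrow> real) \<Rightarrow> real \<Rightarrow> real \<Rightarrow> real" where
  "minus_left_limit g t s = g s - Lim (at_left t) g"

text \<open>Since the Bochner integral is total, integrability is required explicitly.\<close>

definition has_gls_integral ::
  "real \<Rightarrow> real \<Rightarrow> real \<Rightarrow> (real \<Rightarrow> real) \<Rightarrow> (real \<Rightarrow> real) \<Rightarrow> complex \<Rightarrow> bool" where
  "has_gls_integral T \<beta> t h g I \<longleftrightarrow>
     h \<in> besov2 T \<beta> \<and> g \<in> besov1 T (1 - \<beta>) \<and>
     (let F = (\<lambda>s. of_real (frac_deriv_left \<beta> h s) *
                   frac_deriv_right (1 - \<beta>) t (minus_left_limit g t) s)
      in set_integrable lborel {0<..<t} F \<and>
         I = minus_one_powr \<beta> * (LBINT s:{0<..<t}. F s))"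

text \<open>Normal laws include the degenerate ones (variance zero).\<close>

definition gaussian_rv :: "'a measure \<Rightarrow> ('a \<Rightarrow> real) \<Rightarrow> bool" where
  "gaussian_rv M Z \<longleftrightarrow> Z \<in> borel_measurable M \<and>
     (\<exists>\<mu>. (AE \<omega> in M. Z \<omega> = \<mu>) \<or>
          (\<exists>\<sigma>>0. distributed M lborel Z (\<lambda>x. ennreal (normal_density \<mu> \<sigma> x))))"

definition gaussian_process :: "'a measure \<Rightarrow> real \<Rightarrow> (real \<Rightarrow> 'a \<Rightarrow> real) \<Rightarrow> bool" where
  "gaussian_process M T X \<longleftrightarrow>
     (\<forall>F a. finite F \<and> F \<subseteq> {0..T} \<longrightarrow> gaussian_rv M (\<lambda>\<omega>. \<Sum>t\<in>F. a t * X t \<omega>))"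

definition centered_process :: "'a measure \<Rightarrow> real \<Rightarrow> (real \<Rightarrow> 'a \<Rightarrow> real) \<Rightarrow> bool" where
  "centered_process M T X \<longleftrightarrow> (\<forall>t\<in>{0..T}. integral\<^sup>L M (X t) = 0)"

definition continuous_process :: "'a measure \<Rightarrow> real \<Rightarrow> (real \<Rightarrow> 'a \<Rightarrow> real) \<Rightarrow> bool" where
  "continuous_process M T X \<longleftrightarrow> (AE \<omega> in M. continuous_on {0..T} (\<lambda>t. X t \<omega>))"

definition cov_fun :: "'a measure \<Rightarrow> (real \<Rightarrow> 'a \<Rightarrow> real) \<Rightarrow> real \<Rightarrow> real \<Rightarrow> real" where
  "cov_fun M X t s = (\<integral>\<omega>. X t \<omega> * X s \<omega> \<partial>M)"

definition incr_var :: "'a measure \<Rightarrow> (real \<Rightarrow> 'a \<Rightarrow> real) \<Rightarrow> real \<Rightarrow> real \<Rightarrow> real" where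
  "incr_var M X t s = (\<integral>\<omega>. (X t \<omega> - X s \<omega>)\<^sup>2 \<partial>M)"

definition var_fun :: "'a measure \<Rightarrow> (real \<Rightarrow> 'a \<Rightarrow> real) \<Rightarrow> real \<Rightarrow> real" where
  "var_fun M X t = (\<integral>\<omega>. (X t \<omega>)\<^sup>2 \<partial>M)"

definition w_star :: "'a measure \<Rightarrow> real \<Rightarrow> (real \<Rightarrow> 'a \<Rightarrow> real) \<Rightarrow> real \<Rightarrow> ereal" where
  "w_star M T X t = (SUP s\<in>{0..T - t}. ereal (incr_var M X (t + s) s))"

text \<open>
  The suprema are extended-real valued, so the asymptotic expansion of \<open>w_star\<close> includes its
  finiteness near 0; \<open>r\<close> is the remainder.
\<close>

definition class_X :: "'a measure \<Rightarrow> real \<Rightarrow> real \<Rightarrow> (real \<Rightarrow> 'a \<Rightarrow> real) set" where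
  "class_X M T \<alpha> = {X.
     gaussian_process M T X \<and> centered_process M T X \<and> continuous_process M T X \<and>
     (\<forall>s\<in>{0<..T}. \<forall>t\<in>{0<..T}. cov_fun M X s t > 0) \<and>
     (\<exists>C>0. \<exists>r. r \<in> o[at_right 0](\<lambda>t. t powr (2 * \<alpha>)) \<and>
        (\<forall>\<^sub>F t in at_right 0. w_star M T X t = ereal (C * t powr (2 * \<alpha>) + r t))) \<and>
     (\<exists>c>0. \<exists>\<delta>>0. \<forall>s\<in>{0..T}. s \<le> \<delta> \<longrightarrow> var_fun M X s \<ge> c * s\<^sup>2) \<and>
     (\<exists>\<delta>>0. (SUP t\<in>{t. 0 < t \<and> t < 2 * \<delta> \<and> t \<le> T}. SUP s\<in>{t / 2..t}.
               ereal (cov_fun M X s s / cov_fun M X t s)) < \<infinity>)}"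

definition lin_comb_convex :: "(real \<Rightarrow> real) \<Rightarrow> bool" where
  "lin_comb_convex f \<longleftrightarrow>
     (\<exists>(n::nat) (a :: nat \<Rightarrow> real) (g :: nat \<Rightarrow> real \<Rightarrow> real).
        (\<forall>i<n. convex_on UNIV (g i)) \<and> (\<forall>x. f x = (\<Sum>i<n. a i * g i x)))"

definition left_deriv :: "(real \<Rightarrow> real) \<Rightarrow> real \<Rightarrow> real" where
  "left_deriv f x = (THE D. (f has_real_derivative D) (at_left x))"

end

theory Submission
  imports Defs
begin

text \<open>
  Two things have to be shown: almost surely the path \<open>f'\<^sub>-(X)\<close> lies in \<open>W\<^sub>2\<^sup>\<beta>\<close>, and the
  integral exists for every pair \<open>h \<in> W\<^sub>2\<^sup>\<beta>\<close>, \<open>g \<in> W\<^sub>1\<^bsup>1-\<beta>\<^esup>\<close>. The second is deterministic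
  (\<open>gls_integral_exists\<close>): finiteness of the \<open>W\<^sub>2\<^sup>\<beta>\<close> norm makes \<open>D\<^sup>\<beta> h\<close> integrable on \<open>(0,T)\<close>,
  finiteness of the \<open>W\<^sub>1\<^bsup>1-\<beta>\<^esup>\<close> norm makes \<open>g\<close> Hoelder continuous and its fractional derivative from
  the right bounded, and an integrable function times a bounded one is integrable.

  For the first, \<open>f'\<^sub>-\<close> is a linear combination of monotone functions
  (\<open>lin_comb_convex_left_deriv\<close>). Paths of \<open>X\<close> are bounded on
  \<open>[0,T]\<close>, so each of these may be replaced by a function \<open>\<phi>\<close> that is constant outside a bounded
  interval. By Tonelli it suffices to bound \<open>E|\<phi>(X\<^sub>s) - \<phi>(X\<^sub>u)|\<close> for \<open>u < s\<close> well enough that the result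
  can be integrated against \<open>(s - u)\<^bsup>-1-\<beta>\<^esup>\<close>.

  The bound compares two events at a scale \<open>\<delta>\<close> (\<open>expectation_mono_increment_le\<close>).
  If \<open>|X\<^sub>s - X\<^sub>u| \<le> \<delta>\<close>, monotonicity gives
  \<open>|\<phi>(X\<^sub>s) - \<phi>(X\<^sub>u)| \<le> \<phi>(X\<^sub>s + \<delta>) - \<phi>(X\<^sub>s - \<delta>)\<close>; the expectation of the right-hand side involves the
  law of \<open>X\<^sub>s\<close> alone, whose density is at most \<open>1/\<sigma>\<^sub>s\<close>, and the Lebesgue integral of
  \<open>\<phi>(z + \<delta>) - \<phi>(z - \<delta>)\<close> is of order \<open>\<delta>\<close>. The event \<open>|X\<^sub>s - X\<^sub>u| > \<delta>\<close> is controlled by a high moment of the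
  Gaussian increment. Splitting the event reduces the estimate to the one-dimensional laws of \<open>X\<^sub>s\<close> and
  \<open>X\<^sub>s - X\<^sub>u\<close>, at the price of an arbitrarily small loss in the exponent: with \<open>\<delta> = (s - u)\<^sup>\<gamma>\<close> for a \<open>\<gamma>\<close> slightly below \<open>\<alpha>\<close> the bound is a constant times \<open>(s - u)\<^sup>\<gamma> / s\<close>, because
  \<open>\<sigma>\<^sub>s\<close> is at least a constant times \<open>s\<close> on all of \<open>(0,T]\<close> (\<open>class_X_variance_lower\<close>).

  The factor \<open>1/s\<close> is not integrable at 0. Since \<open>\<phi>\<close> is bounded, interpolation with a constant bound
  replaces \<open>(s - u)\<^sup>\<gamma> / s\<close> by its power of exponent \<open>\<theta> < 1\<close> (\<open>class_X_expected_increment\<close>). Because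
  \<open>\<beta> < \<alpha>\<close>, one can choose \<open>\<gamma> < \<alpha>\<close> and \<open>\<theta> < 1\<close> with \<open>\<gamma>\<theta> > \<beta>\<close>, and then the double integral converges
  (\<open>AE_double_integral_finite\<close>).
\<close>

section \<open>Left derivatives of convex functions\<close>

text \<open>
  Difference quotients of a convex function are monotone in both end points. Hence those at \<open>x\<close>
  increase as the other point approaches \<open>x\<close> from the left, and are bounded by the quotient over
  \<open>[x, x + 1]\<close>, so they converge.
\<close>

lemma convex_left_derivative:
  fixes g :: "real \<Rightarrow> real"
  assumes g: "convex_on UNIV g"
  obtains \<phi> where "mono \<phi>" "\<And>x. (g has_real_derivative \<phi> x) (at_left x)"
proof -
  define q where "q x y = (g y - g x) / (y - x)" for x y
  have q_sym: "q x y = q y x" for x y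
    unfolding q_def by (metis minus_diff_eq minus_divide_divide)
  have slope: "q a b \<le> q a c" "q a c \<le> q b c" if "a < b" "b < c" for a b c
    using convex_on_slope_le[OF g _ _ that] q_sym unfolding q_def by auto
  have q_mono: "q x a \<le> q x b" if "a \<le> b" "b < x" for x a b
    using slope(2)[of a b x] that q_sym by (cases "a = b") auto
  have q_bnd: "q x b \<le> q x (x + 1)" if "b < x" for x b
    using slope[of b x "x + 1"] that q_sym by (smt (verit))
  define \<phi> where "\<phi> x = Sup (q x ` {..<x})" for x
  have lim: "(q x \<longlongrightarrow> \<phi> x) (at_left x)" for x
    using Lim_left_bound[of UNIV x "q x" "q x (x + 1)"] q_mono q_bnd by (simp add: \<phi>_def)
  have lower: "q x b \<le> \<phi> x" if "b < x" for x b
    unfolding \<phi>_def using that q_bnd by (intro cSup_upper) (auto intro!: bdd_aboveI2)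
  show thesis
  proof
    show "(g has_real_derivative \<phi> x) (at_left x)" for x
      using lim[of x] by (simp add: has_field_derivative_iff q_def[abs_def])
    show "mono \<phi>"
    proof (rule monoI)
      fix x y :: real assume "x \<le> y"
      show "\<phi> x \<le> \<phi> y"
      proof (cases "x = y")
        case False
        have "q x b \<le> \<phi> y" if "b < x" for b
          using slope[of b x y] lower[of x y] False \<open>x \<le> y\<close> that q_sym by (smt (verit))
        then show ?thesis unfolding \<phi>_def[of x] by (intro cSup_least) (auto intro!: exI[of _ "x - 1"])
      qed simp
    qed
  qed
qed

lemma left_deriv_eq:
  assumes "(f has_real_derivative D) (at_left x)"
  shows "left_deriv f x = D"
  unfolding left_deriv_def
  using assms tendsto_unique[OF trivial_limit_at_left_real]
  by (intro the_equality) (auto simp: has_field_derivative_iff)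

lemma lin_comb_convex_left_deriv:
  assumes "lin_comb_convex f"
  obtains n :: nat and a and \<phi> :: "nat \<Rightarrow> real \<Rightarrow> real"
  where "\<And>i. mono (\<phi> i)" "left_deriv f = (\<lambda>x. \<Sum>i<n. a i * \<phi> i x)"
proof -
  from assms obtain n and a :: "nat \<Rightarrow> real" and g :: "nat \<Rightarrow> real \<Rightarrow> real"
    where g: "\<And>i. i < n \<Longrightarrow> convex_on UNIV (g i)" and f: "\<And>x. f x = (\<Sum>i<n. a i * g i x)"
    unfolding lin_comb_convex_def by blast
  have "\<exists>\<phi>. mono \<phi> \<and> (i < n \<longrightarrow> (\<forall>x. (g i has_real_derivative \<phi> x) (at_left x)))" for i
    by (cases "i < n") (use convex_left_derivative[OF g] in \<open>metis\<close>, auto intro: exI[of _ id] simp: mono_def)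
  then obtain \<phi> where \<phi>: "\<And>i. mono (\<phi> i)"
      "\<And>i x. i < n \<Longrightarrow> (g i has_real_derivative \<phi> i x) (at_left x)" by metis
  have "left_deriv f x = (\<Sum>i<n. a i * \<phi> i x)" for x
    unfolding f[abs_def] by (rule left_deriv_eq) (auto intro!: derivative_eq_intros \<phi>(2) sum.cong)
  with \<phi>(1) show thesis by (intro that[of \<phi> a n]) auto
qed

section \<open>Existence of the integral in terms of Besov spaces\<close>

lemma besov1_hoelder:
  assumes "g \<in> besov1 T \<gamma>"
  obtains K where "K \<ge> 0"
    "\<And>s t. 0 \<le> s \<Longrightarrow> s < t \<Longrightarrow> t \<le> T \<Longrightarrow> \<bar>g t - g s\<bar> \<le> K * (t - s) powr \<gamma>"
    "\<And>s t. 0 \<le> s \<Longrightarrow> s < t \<Longrightarrow> t \<le> T \<Longrightarrow>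
       (\<integral>\<^sup>+u\<in>{s<..<t}. ennreal (\<bar>g u - g s\<bar> / (u - s) powr (1 + \<gamma>)) \<partial>lborel) \<le> ennreal K"
proof -
  define K where "K = enn2real (besov1_norm T \<gamma> g)"
  have K: "besov1_norm T \<gamma> g = ennreal K" "K \<ge> 0"
    using assms by (auto simp: besov1_def K_def less_top)
  have *: "ennreal (\<bar>g t - g s\<bar> / (t - s) powr \<gamma>) +
        (\<integral>\<^sup>+u\<in>{s<..<t}. ennreal (\<bar>g u - g s\<bar> / (u - s) powr (1 + \<gamma>)) \<partial>lborel) \<le> ennreal K"
    if "0 \<le> s" "s < t" "t \<le> T" for s t
    unfolding K(1)[symmetric] besov1_norm_def
    by (rule SUP_upper2[of "(s, t)"]) (use that in auto)
  show thesis
  proof (rule that[OF K(2)])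
    fix s t assume st: "0 \<le> s" "s < t" "t \<le> T"
    have "ennreal (\<bar>g t - g s\<bar> / (t - s) powr \<gamma>) \<le> ennreal K"
      by (rule order_trans[OF _ *[OF st]]) simp
    then show "\<bar>g t - g s\<bar> \<le> K * (t - s) powr \<gamma>"
      using st K(2) by (simp add: field_simps)
    show "(\<integral>\<^sup>+u\<in>{s<..<t}. ennreal (\<bar>g u - g s\<bar> / (u - s) powr (1 + \<gamma>)) \<partial>lborel) \<le> ennreal K"
      by (rule order_trans[OF _ *[OF st]]) simp
  qed
qed

text \<open>
  Hoelder continuity up to the end point turns the left limit that occurs in the definition of the
  integral into an ordinary value.
\<close>

lemma besov1_left_limit:
  assumes g: "g \<in> besov1 T \<gamma>" and "\<gamma> > 0" "T > 0"
  shows "Lim (at_left T) g = g T"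
proof -
  obtain K where "K \<ge> 0"
    and K: "\<And>s t. 0 \<le> s \<Longrightarrow> s < t \<Longrightarrow> t \<le> T \<Longrightarrow> \<bar>g t - g s\<bar> \<le> K * (t - s) powr \<gamma>"
    and "\<And>s t. 0 \<le> s \<Longrightarrow> s < t \<Longrightarrow> t \<le> T \<Longrightarrow>
       (\<integral>\<^sup>+u\<in>{s<..<t}. ennreal (\<bar>g u - g s\<bar> / (u - s) powr (1 + \<gamma>)) \<partial>lborel) \<le> ennreal K"
    using besov1_hoelder[OF g] by blast
  have "((\<lambda>s. K * (T - s) powr \<gamma>) \<longlongrightarrow> K * (T - T) powr \<gamma>) (at_left T)"
    using \<open>\<gamma> > 0\<close> 
    by (intro tendsto_mult tendsto_const tendsto_powr2) (auto intro!: tendsto_eq_intros eventually_at_leftI[of 0] simp: \<open>T > 0\<close>)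
  then have lim0: "((\<lambda>s. K * (T - s) powr \<gamma>) \<longlongrightarrow> 0) (at_left T)" using \<open>\<gamma> > 0\<close> by simp
  have "((\<lambda>s. g s - g T) \<longlongrightarrow> 0) (at_left T)"
  proof (rule Lim_null_comparison[OF _ lim0])
    show "\<forall>\<^sub>F s in at_left T. norm (g s - g T) \<le> K * (T - s) powr \<gamma>"
      by (rule eventually_at_leftI[of 0]) (use K[of _ T] \<open>T > 0\<close> in \<open>auto simp: abs_minus_commute\<close>)
  qed
  then have "(g \<longlongrightarrow> g T) (at_left T)" using LIM_zero_cancel by blast
  then show ?thesis by (intro tendsto_Lim) auto
qed

text \<open>
  Functions of \<open>W\<^sub>1\<close> and \<open>W\<^sub>2\<close> are measurable on \<open>[0,T]\<close> only. A Borel extension makes the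
  measurability of parameter integrals accessible.
\<close>

lemma borel_extension_restrict:
  fixes h :: "real \<Rightarrow> real"
  assumes "h \<in> borel_measurable (restrict_space borel {0..T})"
  obtains k where "k \<in> borel_measurable borel" "\<And>s. s \<in> {0..T} \<Longrightarrow> k s = h s"
proof
  show "(\<lambda>s. indicator {0..T} s *\<^sub>R h s) \<in> borel_measurable borel"
    using assms by (subst (asm) borel_measurable_restrict_space_iff) auto
qed (auto)

text \<open>
  The Bochner integral of a non-integrable function is 0, so the inequality holds for every function.
  It is applied to the inner integrals of the fractional derivatives, which may diverge at some points.
\<close>

lemma norm_integral_le_nn_integral:
  fixes f :: "'a \<Rightarrow> 'b::{banach, second_countable_topology}"
  shows "ennreal (norm (integral\<^sup>L M f)) \<le> (\<integral>\<^sup>+x. ennreal (norm (f x)) \<partial>M)"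
  by (cases "integrable M f") (auto simp: integral_norm_bound_ennreal not_integrable_integral_eq)

text \<open>
  The two parts of \<open>D\<^sup>\<beta> h\<close> are dominated by the integrands of the two parts of the \<open>W\<^sub>2\<^sup>\<beta>\<close> norm.
\<close>

lemma frac_deriv_left_integrable:
  assumes h: "h \<in> besov2 T \<beta>" and \<beta>: "0 < \<beta>" "\<beta> < 1"
  shows "set_integrable lborel {0<..<T} (frac_deriv_left \<beta> h)"
proof -
  have h_meas: "h \<in> borel_measurable (restrict_space borel {0..T})" and
       fin: "besov2_norm T \<beta> h < \<infinity>" using h by (auto simp: besov2_def)
  obtain k where [measurable]: "k \<in> borel_measurable borel" and k: "\<And>s. s \<in> {0..T} \<Longrightarrow> k s = h s"
    using borel_extension_restrict[OF h_meas] by metis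
  define J where "J s = (LBINT u:{0<..<s}. (k s - k u) / (s - u) powr (\<beta> + 1))" for s
  have J_eq: "J s = (LBINT u:{0<..<s}. (h s - h u) / (s - u) powr (\<beta> + 1))" if "s \<in> {0<..<T}" for s
    unfolding J_def using that k by (intro set_lebesgue_integral_cong) auto
  have [measurable]: "J \<in> borel_measurable borel"
  proof -
    have "(\<lambda>s. \<integral>u. (if 0 < u \<and> u < s then (k s - k u) / (s - u) powr (\<beta> + 1) else 0) \<partial>lborel)
            \<in> borel_measurable borel"
      by measurable
    also have "(\<lambda>s. \<integral>u. (if 0 < u \<and> u < s then (k s - k u) / (s - u) powr (\<beta> + 1) else 0) \<partial>lborel) = J"
      unfolding J_def set_lebesgue_integral_def
      by (intro ext Bochner_Integration.integral_cong) (auto simp: indicator_def)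
    finally show ?thesis .
  qed
  have J_bound: "ennreal \<bar>J s\<bar> \<le> (\<integral>\<^sup>+u\<in>{0<..<s}. ennreal (\<bar>h u - h s\<bar> / (s - u) powr (1 + \<beta>)) \<partial>lborel)"
    if s: "s \<in> {0<..<T}" for s
  proof -
    have "ennreal (norm (J s)) \<le> (\<integral>\<^sup>+u. ennreal (norm (indicator {0<..<s} u *\<^sub>R ((k s - k u) / (s - u) powr (\<beta> + 1)))) \<partial>lborel)"
      unfolding J_def set_lebesgue_integral_def by (rule norm_integral_le_nn_integral)
    also have "\<dots> = (\<integral>\<^sup>+u\<in>{0<..<s}. ennreal (\<bar>h u - h s\<bar> / (s - u) powr (1 + \<beta>)) \<partial>lborel)"
      using s k by (intro nn_integral_cong) (auto simp: indicator_def abs_minus_commute add.commute)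
    finally show ?thesis by simp
  qed
  have int: "integrable lborel (\<lambda>s. indicator {0<..<T} s * (k s / s powr \<beta>))"
   "integrable lborel (\<lambda>s. indicator {0<..<T} s * J s)"
  proof -
    have "(\<integral>\<^sup>+s. ennreal (norm (indicator {0<..<T} s * (k s / s powr \<beta>))) \<partial>lborel)
       = (\<integral>\<^sup>+s\<in>{0<..<T}. ennreal (\<bar>h s\<bar> / s powr \<beta>) \<partial>lborel)"
      using k by (intro nn_integral_cong) (auto simp: indicator_def)
    also have "\<dots> \<le> besov2_norm T \<beta> h" unfolding besov2_norm_def by simp
    finally show "integrable lborel (\<lambda>s. indicator {0<..<T} s * (k s / s powr \<beta>))"
      using fin by (intro integrableI_bounded) auto
    have "(\<integral>\<^sup>+s. ennreal (norm (indicator {0<..<T} s * J s)) \<partial>lborel)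
       \<le> (\<integral>\<^sup>+s\<in>{0<..<T}. (\<integral>\<^sup>+u\<in>{0<..<s}. ennreal (\<bar>h u - h s\<bar> / (s - u) powr (1 + \<beta>)) \<partial>lborel) \<partial>lborel)"
      using J_bound by (intro nn_integral_mono) (auto simp: indicator_def)
    also have "\<dots> \<le> besov2_norm T \<beta> h" unfolding besov2_norm_def by simp
    finally show "integrable lborel (\<lambda>s. indicator {0<..<T} s * J s)"
      using fin by (intro integrableI_bounded) auto
  qed
  have "integrable lborel (\<lambda>s. 1 / Gamma (1 - \<beta>) *
          (indicator {0<..<T} s * (k s / s powr \<beta>) + \<beta> * (indicator {0<..<T} s * J s)))"
    using int by auto
  also have "(\<lambda>s. 1 / Gamma (1 - \<beta>) *
          (indicator {0<..<T} s * (k s / s powr \<beta>) + \<beta> * (indicator {0<..<T} s * J s))) =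
     (\<lambda>s. indicator {0<..<T} s *\<^sub>R frac_deriv_left \<beta> h s)"
    using k J_eq by (intro ext) (auto simp: indicator_def frac_deriv_left_def)
  finally show ?thesis unfolding set_integrable_def .
qed

text \<open>
  The pair \<open>s < T\<close> in the supremum that defines the \<open>W\<^sub>1\<^sup>\<gamma>\<close> norm bounds, up to constants, both parts of
  the fractional derivative from the right at \<open>s\<close>. The function \<open>D\<close> serves as a measurable extension by 0
  from \<open>(0,T)\<close> to the line.
\<close>

lemma frac_deriv_right_bounded:
  assumes g: "g \<in> besov1 T \<gamma>" and \<gamma>: "0 < \<gamma>" "\<gamma> < 1" and "T > 0"
  obtains D :: "real \<Rightarrow> complex" and B where "D \<in> borel_measurable borel"
    "\<And>s. norm (D s) \<le> B"
    "\<And>s. s \<in> {0<..<T} \<Longrightarrow> D s = frac_deriv_right \<gamma> T (minus_left_limit g T) s"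
proof -
  have g_meas: "g \<in> borel_measurable (restrict_space borel {0..T})" using g by (auto simp: besov1_def)
  obtain k where [measurable]: "k \<in> borel_measurable borel" and k: "\<And>s. s \<in> {0..T} \<Longrightarrow> k s = g s"
    using borel_extension_restrict[OF g_meas] by metis
  obtain K where K: "K \<ge> 0"
    "\<And>s t. 0 \<le> s \<Longrightarrow> s < t \<Longrightarrow> t \<le> T \<Longrightarrow> \<bar>g t - g s\<bar> \<le> K * (t - s) powr \<gamma>"
    "\<And>s t. 0 \<le> s \<Longrightarrow> s < t \<Longrightarrow> t \<le> T \<Longrightarrow>
       (\<integral>\<^sup>+u\<in>{s<..<t}. ennreal (\<bar>g u - g s\<bar> / (u - s) powr (1 + \<gamma>)) \<partial>lborel) \<le> ennreal K"
    using besov1_hoelder[OF g] by blast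
  define J where "J s = (LBINT u:{s<..<T}. (k s - k u) / (u - s) powr (\<gamma> + 1))" for s
  have J_eq: "J s = (LBINT u:{s<..<T}. (minus_left_limit g T s - minus_left_limit g T u) / (u - s) powr (\<gamma> + 1))"
    if "s \<in> {0<..<T}" for s
    unfolding J_def minus_left_limit_def using that k by (intro set_lebesgue_integral_cong) auto
  have [measurable]: "J \<in> borel_measurable borel"
  proof -
    have "(\<lambda>s. \<integral>u. (if s < u \<and> u < T then (k s - k u) / (u - s) powr (\<gamma> + 1) else 0) \<partial>lborel)
            \<in> borel_measurable borel"
      by measurable
    also have "(\<lambda>s. \<integral>u. (if s < u \<and> u < T then (k s - k u) / (u - s) powr (\<gamma> + 1) else 0) \<partial>lborel) = J"
      unfolding J_def set_lebesgue_integral_def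
      by (intro ext Bochner_Integration.integral_cong) (auto simp: indicator_def)
    finally show ?thesis .
  qed
  have J_bound: "\<bar>J s\<bar> \<le> K" if s: "s \<in> {0<..<T}" for s
  proof -
    have "ennreal (norm (J s)) \<le> (\<integral>\<^sup>+u. ennreal (norm (indicator {s<..<T} u *\<^sub>R ((k s - k u) / (u - s) powr (\<gamma> + 1)))) \<partial>lborel)"
      unfolding J_def set_lebesgue_integral_def by (rule norm_integral_le_nn_integral)
    also have "\<dots> = (\<integral>\<^sup>+u\<in>{s<..<T}. ennreal (\<bar>g u - g s\<bar> / (u - s) powr (1 + \<gamma>)) \<partial>lborel)"
      using s k by (intro nn_integral_cong) (auto simp: indicator_def abs_minus_commute add.commute)
    also have "\<dots> \<le> ennreal K" using K(3)[of s T] s by auto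
    finally show ?thesis using K(1) by simp
  qed
  define G where "G s = k s - g T" for s
  have [measurable]: "G \<in> borel_measurable borel" unfolding G_def by measurable
  have G_bound: "\<bar>G s / (T - s) powr \<gamma>\<bar> \<le> K" if "s \<in> {0<..<T}" for s
    using K(2)[of s T] k[of s] that by (auto simp: G_def field_simps abs_minus_commute)
  define c where "c = minus_one_powr \<gamma> / of_real (Gamma (1 - \<gamma>))"
  define D where "D s = indicator {0<..<T} s *\<^sub>R (c * of_real (G s / (T - s) powr \<gamma> + \<gamma> * J s))" for s
  show thesis
  proof
    show "D \<in> borel_measurable borel" unfolding D_def by measurable
    show "norm (D s) \<le> norm c * (2 * K)" for s
    proof (cases "s \<in> {0<..<T}")
      case True
      have "\<bar>G s / (T - s) powr \<gamma> + \<gamma> * J s\<bar> \<le> \<bar>G s / (T - s) powr \<gamma>\<bar> + \<bar>\<gamma> * J s\<bar>" by (rule abs_triangle_ineq)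
      also have "\<bar>\<gamma> * J s\<bar> \<le> 1 * K" unfolding abs_mult
        using J_bound[OF True] \<gamma> by (intro mult_mono) auto
      finally have "\<bar>G s / (T - s) powr \<gamma> + \<gamma> * J s\<bar> \<le> 2 * K" using G_bound[OF True] by simp
      then show ?thesis unfolding D_def using True
        by (simp add: norm_mult mult_left_mono del: of_real_add of_real_mult of_real_divide)
    qed (use K(1) in \<open>simp add: D_def\<close>)
    show "D s = frac_deriv_right \<gamma> T (minus_left_limit g T) s" if "s \<in> {0<..<T}" for s
      using that k[of s] besov1_left_limit[OF g \<gamma>(1) \<open>T > 0\<close>]
      by (simp add: D_def frac_deriv_right_def J_eq c_def G_def minus_left_limit_def)
  qed
qed

lemma gls_integral_exists:
  assumes h: "h \<in> besov2 T \<beta>" and g: "g \<in> besov1 T (1 - \<beta>)"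
    and \<beta>: "0 < \<beta>" "\<beta> < 1" and T: "T > 0"
  shows "\<exists>I. has_gls_integral T \<beta> T h g I"
proof -
  obtain D B where [measurable]: "D \<in> borel_measurable borel" and D: "\<And>s. norm (D s) \<le> B"
    "\<And>s. s \<in> {0<..<T} \<Longrightarrow> D s = frac_deriv_right (1 - \<beta>) T (minus_left_limit g T) s"
  proof (rule frac_deriv_right_bounded[OF g _ _ T])
    show "0 < 1 - \<beta>" "1 - \<beta> < 1" using \<beta> by auto
  qed blast
  have L: "integrable lborel (\<lambda>s. indicator {0<..<T} s *\<^sub>R frac_deriv_left \<beta> h s)"
    using frac_deriv_left_integrable[OF h \<beta>] unfolding set_integrable_def .
  have "integrable lborel (\<lambda>s. of_real (indicator {0<..<T} s *\<^sub>R frac_deriv_left \<beta> h s) * D s)"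
  proof (rule Bochner_Integration.integrable_bound)
    show "integrable lborel (\<lambda>s. B * (indicator {0<..<T} s *\<^sub>R frac_deriv_left \<beta> h s))" using L by simp
    show "(\<lambda>s. of_real (indicator {0<..<T} s *\<^sub>R frac_deriv_left \<beta> h s) * D s) \<in> borel_measurable lborel"
    proof (rule borel_measurable_times)
      show "(\<lambda>s. complex_of_real (indicator {0<..<T} s *\<^sub>R frac_deriv_left \<beta> h s)) \<in> borel_measurable lborel"
        by (rule measurable_compose[OF borel_measurable_integrable[OF L] borel_measurable_of_real])
    qed simp
    show "AE s in lborel. norm (of_real (indicator {0<..<T} s *\<^sub>R frac_deriv_left \<beta> h s) * D s) \<le> norm (B * (indicator {0<..<T} s *\<^sub>R frac_deriv_left \<beta> h s))"
    proof (rule AE_I2)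
      fix s
      have "norm (of_real (indicator {0<..<T} s *\<^sub>R frac_deriv_left \<beta> h s) * D s)
          \<le> \<bar>indicator {0<..<T} s *\<^sub>R frac_deriv_left \<beta> h s\<bar> * \<bar>B\<bar>"
        unfolding norm_mult norm_of_real
        by (rule mult_left_mono) (use D(1)[of s] in auto)
      then show "norm (of_real (indicator {0<..<T} s *\<^sub>R frac_deriv_left \<beta> h s) * D s)
          \<le> norm (B * (indicator {0<..<T} s *\<^sub>R frac_deriv_left \<beta> h s))"
        by (simp add: abs_mult mult.commute)
    qed
  qed
  also have "(\<lambda>s. of_real (indicator {0<..<T} s *\<^sub>R frac_deriv_left \<beta> h s) * D s) = 
    (\<lambda>s. indicator {0<..<T} s *\<^sub>R (of_real (frac_deriv_left \<beta> h s) *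
                   frac_deriv_right (1 - \<beta>) T (minus_left_limit g T) s))"
    using D(2) by (intro ext) (auto simp: indicator_def)
  finally show ?thesis
    unfolding has_gls_integral_def Let_def set_integrable_def using h g by auto
qed

section \<open>Monotone functions of Gaussian variables\<close>

lemma mono_constant_tails_bounds:
  fixes \<phi> :: "real \<Rightarrow> real"
  assumes \<phi>: "mono \<phi>" "\<And>x. x \<le> -N \<Longrightarrow> \<phi> x = a" "\<And>x. x \<ge> N \<Longrightarrow> \<phi> x = b"
  shows "a \<le> \<phi> x" "\<phi> x \<le> b"
  using \<phi>(2)[of "min x (-N)"] \<phi>(3)[of "max x N"] monoD[OF \<phi>(1), of "min x (-N)" x]
    monoD[OF \<phi>(1), of x "max x N"] by auto

text \<open>
  Subtracting from \<open>\<phi>\<close> the step function with the same limits at \<open>\<plusminus>\<infinity>\<close> leaves an integrable function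
  \<open>\<psi>\<close>. The integral of \<open>\<psi>(z + \<delta>) - \<psi>(z - \<delta>)\<close> vanishes by translation invariance, and the step function
  contributes its jump \<open>b - a\<close> on an interval of length \<open>2\<delta>\<close>.
\<close>

lemma nn_integral_mono_increment_le:
  fixes \<phi> :: "real \<Rightarrow> real"
  assumes \<phi>: "mono \<phi>" "\<And>x. x \<le> -N \<Longrightarrow> \<phi> x = a" "\<And>x. x \<ge> N \<Longrightarrow> \<phi> x = b"
    and "N \<ge> 0" "\<delta> > 0"
  shows "(\<integral>\<^sup>+z. ennreal (\<phi> (z + \<delta>) - \<phi> (z - \<delta>)) \<partial>lborel) \<le> ennreal (2 * \<delta> * (b - a))"
proof -
  have [measurable]: "\<phi> \<in> borel_measurable borel" using \<phi>(1) by (rule borel_measurable_mono)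
  note range = mono_constant_tails_bounds[of \<phi> N a b, OF \<phi>]
  define \<psi> where "\<psi> z = \<phi> z - (if z \<ge> 0 then b else a)" for z
  have [measurable]: "\<psi> \<in> borel_measurable borel" unfolding \<psi>_def by measurable
  have int: "integrable lborel \<psi>"
  proof (rule Bochner_Integration.integrable_bound)
    show "integrable lborel (\<lambda>z. (b - a) * indicator {-N..N} z)"
      by (intro integrable_mult_right integrable_real_indicator) (auto simp: emeasure_lborel_Icc_eq)
    show "AE z in lborel. norm (\<psi> z) \<le> norm ((b - a) * indicator {-N..N} z)"
    proof (rule AE_I2)
      fix z
      show "norm (\<psi> z) \<le> norm ((b - a) * indicator {-N..N} z)"
        using range[of z] \<phi>(2)[of z] \<phi>(3)[of z] \<open>N \<ge> 0\<close> by (auto simp: \<psi>_def indicator_def)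
    qed
  qed simp
  have shift: "integrable lborel (\<lambda>z. \<psi> (t + z))" "(\<integral>z. \<psi> (t + z) \<partial>lborel) = (\<integral>z. \<psi> z \<partial>lborel)" for t
    using lborel_integrable_real_affine[OF int, of 1 t] lborel_integral_real_affine[of 1 \<psi> t] by simp_all
  \<comment> \<open>The step function jumps at 0, which lies between \<open>z - \<delta>\<close> and \<open>z + \<delta>\<close> exactly for these \<open>z\<close>.\<close>
  have eq: "\<phi> (z + \<delta>) - \<phi> (z - \<delta>) = \<psi> (\<delta> + z) - \<psi> (-\<delta> + z) + (b - a) * indicator {-\<delta>..<\<delta>} z" for z
    using \<open>\<delta> > 0\<close> by (auto simp: \<psi>_def indicator_def add.commute)
  have ind: "integrable lborel (indicator {-\<delta>..<\<delta>} :: real \<Rightarrow> real)"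
    using \<open>\<delta> > 0\<close> by (intro integrable_real_indicator) auto
  have incr: "integrable lborel (\<lambda>z. \<phi> (z + \<delta>) - \<phi> (z - \<delta>))"
    unfolding eq
    by (intro Bochner_Integration.integrable_add Bochner_Integration.integrable_diff
        integrable_mult_right shift(1) ind)
  have "(\<integral>\<^sup>+z. ennreal (\<phi> (z + \<delta>) - \<phi> (z - \<delta>)) \<partial>lborel) = ennreal (\<integral>z. \<phi> (z + \<delta>) - \<phi> (z - \<delta>) \<partial>lborel)"
    using \<open>\<delta> > 0\<close> by (intro nn_integral_eq_integral incr AE_I2) (simp add: monoD[OF \<phi>(1)])
  also have "(\<integral>z. \<phi> (z + \<delta>) - \<phi> (z - \<delta>) \<partial>lborel) = 2 * \<delta> * (b - a)"
    unfolding eq using \<open>\<delta> > 0\<close> shift(1)[of \<delta>] shift(1)[of "-\<delta>"] ind shift(2)[of \<delta>] shift(2)[of "-\<delta>"]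
    by (simp add: mult.commute)
  finally show ?thesis by simp
qed

lemma normal_density_le: "\<sigma> > 0 \<Longrightarrow> normal_density \<mu> \<sigma> x \<le> 1 / \<sigma>"
proof -
  assume "\<sigma> > 0"
  have "sqrt (2 * pi * \<sigma>\<^sup>2) = sqrt (2 * pi) * \<sigma>" using \<open>\<sigma> > 0\<close> by (simp add: real_sqrt_mult)
  moreover have "1 \<le> sqrt (2 * pi)" using pi_ge_two by simp
  ultimately have "\<sigma> \<le> sqrt (2 * pi * \<sigma>\<^sup>2)" using \<open>\<sigma> > 0\<close> by simp
  then have "1 / sqrt (2 * pi * \<sigma>\<^sup>2) * exp (- (x - \<mu>)\<^sup>2 / (2 * \<sigma>\<^sup>2)) \<le> 1 / \<sigma> * 1"
    using \<open>\<sigma> > 0\<close> by (intro mult_mono divide_left_mono) auto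
  then show ?thesis by (simp add: normal_density_def)
qed

context prob_space
begin

lemma gaussian_rv_integrable:
  assumes "gaussian_rv M Z"
  shows "integrable M Z"
proof -
  from assms have [measurable]: "Z \<in> borel_measurable M" by (simp add: gaussian_rv_def)
  from assms consider \<mu> where "AE \<omega> in M. Z \<omega> = \<mu>"
    | \<mu> \<sigma> where "\<sigma> > 0" "distributed M lborel Z (\<lambda>x. ennreal (normal_density \<mu> \<sigma> x))"
    unfolding gaussian_rv_def by blast
  then show ?thesis
  proof cases
    case 1
    then show ?thesis using integrable_cong_AE[of Z M "\<lambda>_. \<mu>"] by simp
  next
    case 2
    then show ?thesis
      using distributed_integrable_var[OF 2(2)] integrable_normal_moment_nz_1[OF 2(1)] by simp
  qed
qed

text \<open>
  A degenerate centered Gaussian variable vanishes almost surely, which the moment formulas below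
  have to cover because increments of the process may have variance 0.
\<close>

lemma centered_gaussian_cases:
  assumes Z: "gaussian_rv M Z" "expectation Z = 0"
  obtains "AE \<omega> in M. Z \<omega> = 0"
    | \<sigma> where "\<sigma> > 0" "distributed M lborel Z (\<lambda>x. ennreal (normal_density 0 \<sigma> x))"
proof -
  from Z(1) have [measurable]: "Z \<in> borel_measurable M" by (simp add: gaussian_rv_def)
  from Z(1) consider \<mu> where "AE \<omega> in M. Z \<omega> = \<mu>"
    | \<mu> \<sigma> where "\<sigma> > 0" "distributed M lborel Z (\<lambda>x. ennreal (normal_density \<mu> \<sigma> x))"
    unfolding gaussian_rv_def by blast
  then show thesis
  proof cases
    case 1
    then have "expectation Z = \<mu>" using integral_cong_AE[of Z M "\<lambda>_. \<mu>"] by (simp add: prob_space)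
    with Z(2) 1 that(1) show thesis by simp
  next
    case 2
    with normal_distributed_expectation[OF 2] Z(2) that(2) show thesis by simp
  qed
qed

lemma centered_gaussian_even_moment:
  assumes Z: "gaussian_rv M Z" "expectation Z = 0"
  shows "integrable M (\<lambda>\<omega>. Z \<omega> ^ (2 * m))"
    and "expectation (\<lambda>\<omega>. Z \<omega> ^ (2 * m)) = fact (2 * m) / (2 ^ m * fact m) * (expectation (\<lambda>\<omega>. (Z \<omega>)\<^sup>2)) ^ m"
proof -
  from Z(1) have [measurable]: "Z \<in> borel_measurable M" by (simp add: gaussian_rv_def)
  have "integrable M (\<lambda>\<omega>. Z \<omega> ^ (2 * m)) \<and>
    expectation (\<lambda>\<omega>. Z \<omega> ^ (2 * m)) = fact (2 * m) / (2 ^ m * fact m) * (expectation (\<lambda>\<omega>. (Z \<omega>)\<^sup>2)) ^ m"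
    using Z
  proof (cases rule: centered_gaussian_cases)
    case 1
    have "integrable M (\<lambda>\<omega>. Z \<omega> ^ (2 * m)) \<longleftrightarrow> integrable M (\<lambda>\<omega>. 0 ^ (2 * m) :: real)"
      by (rule integrable_cong_AE) (use 1 in auto)
    moreover have "expectation (\<lambda>\<omega>. Z \<omega> ^ (2 * m)) = expectation (\<lambda>\<omega>. 0 ^ (2 * m))"
      by (rule integral_cong_AE) (use 1 in auto)
    moreover have "expectation (\<lambda>\<omega>. (Z \<omega>)\<^sup>2) = expectation (\<lambda>\<omega>. 0)"
      by (rule integral_cong_AE) (use 1 in auto)
    ultimately show ?thesis by (cases m) (auto simp: prob_space)
  next
    case (2 \<sigma>)
    have mom: "expectation (\<lambda>\<omega>. Z \<omega> ^ (2 * k)) = fact (2 * k) / ((2 / \<sigma>\<^sup>2) ^ k * fact k)" for k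
      using integral_normal_moment_even[OF 2(1), of 0 k]
      by (subst distributed_integral[OF 2(2), symmetric]) auto
    have "integrable M (\<lambda>\<omega>. Z \<omega> ^ (2 * m))"
      using integrable_normal_moment[OF 2(1), of 0 "2 * m"]
      by (subst distributed_integrable[OF 2(2), symmetric]) auto
    moreover have "expectation (\<lambda>\<omega>. (Z \<omega>)\<^sup>2) = \<sigma>\<^sup>2" using mom[of 1] by (simp add: eval_nat_numeral)
    ultimately show ?thesis using mom[of m] by (simp add: power_divide)
  qed
  then show "integrable M (\<lambda>\<omega>. Z \<omega> ^ (2 * m))"
    and "expectation (\<lambda>\<omega>. Z \<omega> ^ (2 * m)) = fact (2 * m) / (2 ^ m * fact m) * (expectation (\<lambda>\<omega>. (Z \<omega>)\<^sup>2)) ^ m"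
    by auto
qed

text \<open>
  Markov's inequality for an arbitrary even moment: the tail decays faster than any power, measured in
  units of the standard deviation.
\<close>

lemma centered_gaussian_tail:
  assumes Z: "gaussian_rv M Z" "expectation Z = 0" and "\<delta> > 0"
  shows "(\<integral>\<^sup>+\<omega>. indicator {\<omega>. \<delta> < \<bar>Z \<omega>\<bar>} \<omega> \<partial>M) \<le>
    ennreal (fact (2 * m) / (2 ^ m * fact m) * (expectation (\<lambda>\<omega>. (Z \<omega>)\<^sup>2)) ^ m / \<delta> ^ (2 * m))"
proof -
  have "(\<integral>\<^sup>+\<omega>. indicator {\<omega>. \<delta> < \<bar>Z \<omega>\<bar>} \<omega> \<partial>M) \<le> (\<integral>\<^sup>+\<omega>. ennreal (Z \<omega> ^ (2 * m) / \<delta> ^ (2 * m)) \<partial>M)"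
  proof (rule nn_integral_mono)
    fix \<omega>
    have "1 \<le> Z \<omega> ^ (2 * m) / \<delta> ^ (2 * m)" if "\<delta> < \<bar>Z \<omega>\<bar>"
      using power_mono[of \<delta> "\<bar>Z \<omega>\<bar>" "2 * m"] that \<open>\<delta> > 0\<close> by (simp add: power_even_abs)
    then show "indicator {\<omega>. \<delta> < \<bar>Z \<omega>\<bar>} \<omega> \<le> ennreal (Z \<omega> ^ (2 * m) / \<delta> ^ (2 * m))"
      by (auto simp: indicator_def ennreal_1[symmetric] simp del: ennreal_1 intro!: ennreal_leI)
  qed
  also have "\<dots> = ennreal (expectation (\<lambda>\<omega>. Z \<omega> ^ (2 * m) / \<delta> ^ (2 * m)))"
    using centered_gaussian_even_moment(1)[OF Z, of m] \<open>\<delta> > 0\<close>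
    by (intro nn_integral_eq_integral) auto
  also have "expectation (\<lambda>\<omega>. Z \<omega> ^ (2 * m) / \<delta> ^ (2 * m)) =
      fact (2 * m) / (2 ^ m * fact m) * (expectation (\<lambda>\<omega>. (Z \<omega>)\<^sup>2)) ^ m / \<delta> ^ (2 * m)"
    using centered_gaussian_even_moment(2)[OF Z, of m] by simp
  finally show ?thesis .
qed

text \<open>
  The scale \<open>\<delta>\<close> separates small increments \<open>Z - Z'\<close>, where monotonicity reduces everything to the law of
  \<open>Z\<close>, from large ones, where the total oscillation \<open>b - a\<close> is multiplied by a small probability.
\<close>

lemma expectation_mono_increment_le:
  fixes \<phi> :: "real \<Rightarrow> real"
  assumes \<phi>: "mono \<phi>" "\<And>x. x \<le> -N \<Longrightarrow> \<phi> x = a" "\<And>x. x \<ge> N \<Longrightarrow> \<phi> x = b" and "N \<ge> 0"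
    and Z: "\<sigma> > 0" "distributed M lborel Z (\<lambda>x. ennreal (normal_density 0 \<sigma> x))"
    and D: "gaussian_rv M (\<lambda>\<omega>. Z \<omega> - Z' \<omega>)" "expectation (\<lambda>\<omega>. Z \<omega> - Z' \<omega>) = 0"
    and "\<delta> > 0"
  shows "(\<integral>\<^sup>+\<omega>. ennreal \<bar>\<phi> (Z \<omega>) - \<phi> (Z' \<omega>)\<bar> \<partial>M) \<le>
    ennreal ((b - a) * (2 * \<delta> / \<sigma> +
      fact (2 * m) / (2 ^ m * fact m) * (expectation (\<lambda>\<omega>. (Z \<omega> - Z' \<omega>)\<^sup>2)) ^ m / \<delta> ^ (2 * m)))"
proof -
  have [measurable]: "\<phi> \<in> borel_measurable borel" using \<phi>(1) by (rule borel_measurable_mono)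
  have [measurable]: "Z \<in> borel_measurable M" using Z(2) by (auto dest: distributed_measurable)
  have [measurable]: "(\<lambda>\<omega>. Z \<omega> - Z' \<omega>) \<in> borel_measurable M" using D by (simp add: gaussian_rv_def)
  note range = mono_constant_tails_bounds[of \<phi> N a b, OF \<phi>]
  then have "a \<le> b" by (meson order_trans)
  let ?c = "fact (2 * m) / (2 ^ m * fact m) * (expectation (\<lambda>\<omega>. (Z \<omega> - Z' \<omega>)\<^sup>2)) ^ m / \<delta> ^ (2 * m)"
  let ?A = "\<lambda>z. ennreal (\<phi> (z + \<delta>) - \<phi> (z - \<delta>))"
  let ?T = "indicator {\<omega>. \<delta> < \<bar>Z \<omega> - Z' \<omega>\<bar>} :: _ \<Rightarrow> ennreal"
  have pointwise: "ennreal \<bar>\<phi> (Z \<omega>) - \<phi> (Z' \<omega>)\<bar> \<le> ?A (Z \<omega>) + ennreal (b - a) * ?T \<omega>" for \<omega>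
  proof (cases "\<delta> < \<bar>Z \<omega> - Z' \<omega>\<bar>")
    case True
    have "ennreal \<bar>\<phi> (Z \<omega>) - \<phi> (Z' \<omega>)\<bar> \<le> ennreal (b - a)"
      using range[of "Z \<omega>"] range[of "Z' \<omega>"] by (intro ennreal_leI) auto
    then show ?thesis using True by (simp add: add_increasing)
  next
    case False
    have "\<phi> (Z \<omega> - \<delta>) \<le> \<phi> (Z \<omega>)" "\<phi> (Z \<omega>) \<le> \<phi> (Z \<omega> + \<delta>)"
      "\<phi> (Z \<omega> - \<delta>) \<le> \<phi> (Z' \<omega>)" "\<phi> (Z' \<omega>) \<le> \<phi> (Z \<omega> + \<delta>)"
      using False \<open>\<delta> > 0\<close> by (auto intro!: monoD[OF \<phi>(1)])
    then show ?thesis using False by (auto intro!: ennreal_leI)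
  qed
  have "(\<integral>\<^sup>+\<omega>. ?A (Z \<omega>) \<partial>M) = (\<integral>\<^sup>+z. ennreal (normal_density 0 \<sigma> z) * ?A z \<partial>lborel)"
    by (rule distributed_nn_integral[OF Z(2), symmetric]) measurable
  also have "\<dots> \<le> (\<integral>\<^sup>+z. ennreal (1 / \<sigma>) * ?A z \<partial>lborel)"
    using normal_density_le[OF Z(1)] by (intro nn_integral_mono mult_right_mono ennreal_leI) auto
  also have "\<dots> = ennreal (1 / \<sigma>) * (\<integral>\<^sup>+z. ?A z \<partial>lborel)" by (rule nn_integral_cmult) measurable
  also have "\<dots> \<le> ennreal (1 / \<sigma>) * ennreal (2 * \<delta> * (b - a))"
    using nn_integral_mono_increment_le[OF \<phi> \<open>N \<ge> 0\<close> \<open>\<delta> > 0\<close>] by (intro mult_left_mono) auto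
  also have "\<dots> = ennreal ((b - a) * (2 * \<delta> / \<sigma>))"
    using Z(1) by (subst ennreal_mult'[symmetric]) (auto simp: field_simps)
  finally have near: "(\<integral>\<^sup>+\<omega>. ?A (Z \<omega>) \<partial>M) \<le> ennreal ((b - a) * (2 * \<delta> / \<sigma>))" .
  have "(\<integral>\<^sup>+\<omega>. ennreal (b - a) * ?T \<omega> \<partial>M) = ennreal (b - a) * (\<integral>\<^sup>+\<omega>. ?T \<omega> \<partial>M)"
    by (rule nn_integral_cmult) measurable
  also have "\<dots> \<le> ennreal (b - a) * ennreal ?c"
    using centered_gaussian_tail[OF D \<open>\<delta> > 0\<close>, of m] by (intro mult_left_mono) auto
  also have "\<dots> = ennreal ((b - a) * ?c)" using \<open>a \<le> b\<close> by (intro ennreal_mult'[symmetric]) simp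
  finally have far: "(\<integral>\<^sup>+\<omega>. ennreal (b - a) * ?T \<omega> \<partial>M) \<le> ennreal ((b - a) * ?c)" .
  have "(\<integral>\<^sup>+\<omega>. ennreal \<bar>\<phi> (Z \<omega>) - \<phi> (Z' \<omega>)\<bar> \<partial>M) \<le> (\<integral>\<^sup>+\<omega>. ?A (Z \<omega>) + ennreal (b - a) * ?T \<omega> \<partial>M)"
    by (intro nn_integral_mono pointwise)
  also have "\<dots> = (\<integral>\<^sup>+\<omega>. ?A (Z \<omega>) \<partial>M) + (\<integral>\<^sup>+\<omega>. ennreal (b - a) * ?T \<omega> \<partial>M)"
    by (rule nn_integral_add) measurable
  also have "\<dots> \<le> ennreal ((b - a) * (2 * \<delta> / \<sigma>)) + ennreal ((b - a) * ?c)"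
    by (intro add_mono near far)
  also have "\<dots> = ennreal ((b - a) * (2 * \<delta> / \<sigma>) + (b - a) * ?c)"
    using \<open>a \<le> b\<close> Z(1) \<open>\<delta> > 0\<close> by (intro ennreal_plus[symmetric]) auto
  finally show ?thesis by (simp add: distrib_left)
qed

end

section \<open>Almost sure finiteness of the double integral\<close>

lemma nn_integral_powr_from_0:
  fixes p c :: real
  assumes "p > -1" "c \<ge> 0"
  shows "(\<integral>\<^sup>+u\<in>{0<..<c}. ennreal (u powr p) \<partial>lborel) = ennreal (c powr (p + 1) / (p + 1))"
proof -
  have "((\<lambda>x. x powr p) has_integral (c powr (p + 1) / (p + 1))) {0..c}"
    using has_integral_powr_from_0[of p c] assms by simp
  then have "((\<lambda>x. if x \<in> {0..c} then x powr p else 0) has_integral (c powr (p + 1) / (p + 1))) UNIV"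
    by (rule iffD2[OF has_integral_restrict_UNIV])
  moreover have "(\<lambda>x. if x \<in> {0..c} then x powr p else 0) \<in> borel_measurable borel" by measurable
  ultimately have "(\<integral>\<^sup>+u. ennreal (if u \<in> {0..c} then u powr p else 0) \<partial>lborel) = ennreal (c powr (p + 1) / (p + 1))"
    by (intro nn_integral_has_integral_lborel) simp_all
  also have "(\<integral>\<^sup>+u. ennreal (if u \<in> {0..c} then u powr p else 0) \<partial>lborel) = (\<integral>\<^sup>+u\<in>{0<..<c}. ennreal (u powr p) \<partial>lborel)"
    using AE_lborel_singleton[of c] AE_lborel_singleton[of 0]
    by (intro nn_integral_cong_AE, eventually_elim) (auto simp: indicator_def)
  finally show ?thesis .
qed

lemma nn_integral_powr_from_right:
  fixes p c :: real
  assumes "p > -1" "c \<ge> 0"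
  shows "(\<integral>\<^sup>+u\<in>{0<..<c}. ennreal ((c - u) powr p) \<partial>lborel) = ennreal (c powr (p + 1) / (p + 1))"
proof -
  have "(\<integral>\<^sup>+u\<in>{0<..<c}. ennreal (u powr p) \<partial>lborel) =
        (\<integral>\<^sup>+u\<in>{0<..<c}. ennreal ((c - u) powr p) \<partial>lborel)"
    by (subst nn_integral_real_affine[where c="-1" and t=c])
       (auto intro!: nn_integral_cong simp: indicator_def)
  with nn_integral_powr_from_0[OF assms] show ?thesis by simp
qed

lemma tendsto_floor_grid: "(\<lambda>n. real_of_int \<lfloor>real (Suc n) * t\<rfloor> / real (Suc n)) \<longlonglongrightarrow> t"
proof -
  have "(\<lambda>n. real_of_int \<lfloor>real (Suc n) * t\<rfloor> / real (Suc n) - t) \<longlonglongrightarrow> 0"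
  proof (rule Lim_null_comparison)
    show "\<forall>\<^sub>F n in sequentially. norm (real_of_int \<lfloor>real (Suc n) * t\<rfloor> / real (Suc n) - t) \<le> inverse (real (Suc n))"
    proof (rule always_eventually, rule allI)
      fix n
      have "real_of_int \<lfloor>real (Suc n) * t\<rfloor> / real (Suc n) - t =
          (real_of_int \<lfloor>real (Suc n) * t\<rfloor> - real (Suc n) * t) / real (Suc n)"
        by (simp add: diff_divide_distrib del: of_nat_Suc)
      also have "norm \<dots> \<le> 1 / real (Suc n)"
        unfolding norm_divide by (rule divide_mono) (simp_all, linarith)
      finally show "norm (real_of_int \<lfloor>real (Suc n) * t\<rfloor> / real (Suc n) - t) \<le> inverse (real (Suc n))"
        by (simp add: inverse_eq_divide)
    qed
  qed (rule LIMSEQ_inverse_real_of_nat)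
  then show ?thesis by (rule LIM_zero_cancel)
qed

text \<open>
  Tonelli's theorem requires joint measurability, but the paths are continuous only almost surely and
  only on \<open>[0,T]\<close>. The version \<open>Z\<close> is 0 on a measurable null set and is frozen outside \<open>[0,T]\<close>; all its
  paths are continuous, so it is the limit of its values at the grid points \<open>\<lfloor>n t\<rfloor> / n\<close>, and there are
  countably many grid points.
\<close>

lemma continuous_process_jointly_measurable_version:
  fixes X :: "real \<Rightarrow> 'a \<Rightarrow> real"
  assumes "T \<ge> 0" and meas: "\<And>t. t \<in> {0..T} \<Longrightarrow> X t \<in> borel_measurable M"
    and cont: "continuous_process M T X"
  obtains Z where "(\<lambda>(\<omega>, t). Z t \<omega>) \<in> borel_measurable (M \<Otimes>\<^sub>M borel)"
    "AE \<omega> in M. \<forall>t\<in>{0..T}. Z t \<omega> = X t \<omega>"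
proof -
  from cont have "AE \<omega> in M. continuous_on {0..T} (\<lambda>t. X t \<omega>)" by (simp add: continuous_process_def)
  then obtain N where N: "{\<omega> \<in> space M. \<not> continuous_on {0..T} (\<lambda>t. X t \<omega>)} \<subseteq> N" "emeasure M N = 0"
    and [measurable]: "N \<in> sets M" by (rule AE_E)
  define clamp where "clamp t = max 0 (min T t)" for t
  have clamp: "clamp t \<in> {0..T}" for t using \<open>T \<ge> 0\<close> by (auto simp: clamp_def)
  have clamp_id: "clamp t = t" if "t \<in> {0..T}" for t using that by (auto simp: clamp_def)
  have clamp_cont: "continuous_on UNIV clamp" unfolding clamp_def by (intro continuous_intros)
  define Z where "Z t \<omega> = (if \<omega> \<in> N then 0 else X (clamp t) \<omega>)" for t \<omega>
  have [measurable]: "Z t \<in> borel_measurable M" for t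
    unfolding Z_def using meas[OF clamp] by measurable
  have Z_cont: "continuous_on UNIV (\<lambda>t. Z t \<omega>)" if "\<omega> \<in> space M" for \<omega>
  proof (cases "\<omega> \<in> N")
    case False
    with N(1) that have "continuous_on {0..T} (\<lambda>t. X t \<omega>)" by auto
    then have "continuous_on UNIV (\<lambda>t. X (clamp t) \<omega>)"
      by (rule continuous_on_compose2[OF _ clamp_cont]) (use clamp in auto)
    with False show ?thesis by (simp add: Z_def)
  qed (simp add: Z_def)
  show thesis
  proof
    let ?g = "\<lambda>n (\<omega>, t). Z (real_of_int \<lfloor>real (Suc n) * t\<rfloor> / real (Suc n)) \<omega>"
    show "(\<lambda>(\<omega>, t). Z t \<omega>) \<in> borel_measurable (M \<Otimes>\<^sub>M borel)"
    proof (rule borel_measurable_LIMSEQ_real)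
      show "?g n \<in> borel_measurable (M \<Otimes>\<^sub>M borel)" for n
      proof -
        have "(\<lambda>p. (\<lambda>i p. Z (real_of_int i / real (Suc n)) (fst p)) \<lfloor>real (Suc n) * snd p\<rfloor> p)
          \<in> borel_measurable (M \<Otimes>\<^sub>M borel)"
          by (rule measurable_compose_countable) measurable
        then show ?thesis by (simp add: case_prod_beta')
      qed
      show "(\<lambda>n. ?g n p) \<longlonglongrightarrow> (case p of (\<omega>, t) \<Rightarrow> Z t \<omega>)" if "p \<in> space (M \<Otimes>\<^sub>M borel)" for p
      proof -
        obtain \<omega> t where p: "p = (\<omega>, t)" by (cases p)
        with that have "\<omega> \<in> space M" by (auto simp: space_pair_measure)
        from Z_cont[OF this] have "isCont (\<lambda>t. Z t \<omega>) t" by (simp add: continuous_on_eq_continuous_at)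
        from isCont_tendsto_compose[OF this tendsto_floor_grid] show ?thesis by (simp add: p)
      qed
    qed
    have "AE \<omega> in M. \<omega> \<notin> N" using N(2) by (intro AE_not_in) auto
    then show "AE \<omega> in M. \<forall>t\<in>{0..T}. Z t \<omega> = X t \<omega>"
      by eventually_elim (simp add: Z_def clamp_id)
  qed
qed

context prob_space
begin

text \<open>
  After taking expectations the integrand is at most \<open>C (s - u)\<^bsup>\<kappa>-1-\<beta>\<^esup> s\<^bsup>-\<theta>\<^esup>\<close>. This is integrable
  in \<open>u\<close> because \<open>\<kappa> > \<beta>\<close> and then in \<open>s\<close> because \<open>\<theta> < 1\<close>.
\<close>

lemma AE_double_integral_finite:
  fixes Z :: "real \<Rightarrow> 'a \<Rightarrow> real"
  assumes Z: "(\<lambda>(\<omega>, t). Z t \<omega>) \<in> borel_measurable (M \<Otimes>\<^sub>M borel)"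
    and bound: "\<And>u s. 0 < u \<Longrightarrow> u < s \<Longrightarrow> s < T \<Longrightarrow>
      (\<integral>\<^sup>+\<omega>. ennreal \<bar>Z u \<omega> - Z s \<omega>\<bar> \<partial>M) \<le> ennreal (C * (s - u) powr \<kappa> * s powr (- \<theta>))"
    and "C \<ge> 0" "\<beta> < \<kappa>" "\<theta> < 1" "T \<ge> 0"
  shows "AE \<omega> in M. (\<integral>\<^sup>+s\<in>{0<..<T}.
      (\<integral>\<^sup>+u\<in>{0<..<s}. ennreal (\<bar>Z u \<omega> - Z s \<omega>\<bar> / (s - u) powr (1 + \<beta>)) \<partial>lborel) \<partial>lborel) < \<infinity>"
proof -
  define F where "F \<omega> s u = (if 0 < u \<and> u < s \<and> s < T
    then ennreal (\<bar>Z u \<omega> - Z s \<omega>\<bar> / (s - u) powr (1 + \<beta>)) else 0)" for \<omega> s u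
  \<comment> \<open>Joint measurability in a form in which time and randomness may come from any product component.\<close>
  have Z': "(\<lambda>p. Z (h p) (f p)) \<in> borel_measurable N"
    if [measurable]: "f \<in> measurable N M" "h \<in> borel_measurable N" for N :: "'z measure" and f h
    using measurable_compose[of "\<lambda>p. (f p, h p)" N, OF _ Z] by simp
  have Z1[measurable]: "Z t \<in> borel_measurable M" for t by (rule Z') auto
  have F3[measurable]: "(\<lambda>(p, u). F (fst p) (snd p) u) \<in> borel_measurable ((M \<Otimes>\<^sub>M lborel) \<Otimes>\<^sub>M lborel)"
    unfolding F_def case_prod_beta'
    using Z'[of "\<lambda>p. fst (fst p)" "(M \<Otimes>\<^sub>M lborel) \<Otimes>\<^sub>M lborel" snd]
      Z'[of "\<lambda>p. fst (fst p)" "(M \<Otimes>\<^sub>M lborel) \<Otimes>\<^sub>M lborel" "\<lambda>p. snd (fst p)"]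
    by measurable
  have F2[measurable]: "(\<lambda>(\<omega>, u). F \<omega> s u) \<in> borel_measurable (M \<Otimes>\<^sub>M lborel)" for s
    unfolding F_def case_prod_beta'
    using Z'[of fst "M \<Otimes>\<^sub>M lborel" snd] Z'[of fst "M \<Otimes>\<^sub>M lborel" "\<lambda>_. s"]
    by measurable
  have FI[measurable]: "(\<lambda>(\<omega>, s). \<integral>\<^sup>+u. F \<omega> s u \<partial>lborel) \<in> borel_measurable (M \<Otimes>\<^sub>M lborel)"
    using lborel.borel_measurable_nn_integral_fst[OF F3] by (simp add: case_prod_beta')
  interpret P: pair_sigma_finite M lborel ..
  define G where "G \<omega> = (\<integral>\<^sup>+s. \<integral>\<^sup>+u. F \<omega> s u \<partial>lborel \<partial>lborel)" for \<omega>
  have G_eq: "G \<omega> = (\<integral>\<^sup>+s\<in>{0<..<T}.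
      (\<integral>\<^sup>+u\<in>{0<..<s}. ennreal (\<bar>Z u \<omega> - Z s \<omega>\<bar> / (s - u) powr (1 + \<beta>)) \<partial>lborel) \<partial>lborel)" for \<omega>
    unfolding G_def
  proof (rule nn_integral_cong)
    fix s
    show "(\<integral>\<^sup>+u. F \<omega> s u \<partial>lborel) = (\<integral>\<^sup>+u\<in>{0<..<s}. ennreal (\<bar>Z u \<omega> - Z s \<omega>\<bar> / (s - u) powr (1 + \<beta>)) \<partial>lborel)
        * indicator {0<..<T} s"
    proof (cases "s \<in> {0<..<T}")
      case True
      then have "(\<integral>\<^sup>+u. F \<omega> s u \<partial>lborel) = (\<integral>\<^sup>+u\<in>{0<..<s}. ennreal (\<bar>Z u \<omega> - Z s \<omega>\<bar> / (s - u) powr (1 + \<beta>)) \<partial>lborel)"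
        by (intro nn_integral_cong) (auto simp: F_def indicator_def)
      with True show ?thesis by simp
    next
      case False
      then have "F \<omega> s = (\<lambda>_. 0)" by (auto simp: F_def fun_eq_iff)
      with False show ?thesis by simp
    qed
  qed
  let ?p = "\<kappa> - \<beta> - 1"
  have inner: "(\<integral>\<^sup>+\<omega>. F \<omega> s u \<partial>M) \<le> ennreal (C * s powr (- \<theta>)) * (ennreal ((s - u) powr ?p) * indicator {0<..<s} u)"
    if s: "s \<in> {0<..<T}" for s u
  proof (cases "u \<in> {0<..<s}")
    case True
    then have us: "0 < u" "u < s" "s < T" using s by auto
    have "(\<integral>\<^sup>+\<omega>. F \<omega> s u \<partial>M) = (\<integral>\<^sup>+\<omega>. ennreal \<bar>Z u \<omega> - Z s \<omega>\<bar> * ennreal (1 / (s - u) powr (1 + \<beta>)) \<partial>M)"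
      using us by (intro nn_integral_cong) (simp add: F_def ennreal_mult'[symmetric])
    also have "\<dots> = (\<integral>\<^sup>+\<omega>. ennreal \<bar>Z u \<omega> - Z s \<omega>\<bar> \<partial>M) * ennreal (1 / (s - u) powr (1 + \<beta>))"
      by (rule nn_integral_multc) measurable
    also have "\<dots> \<le> ennreal (C * (s - u) powr \<kappa> * s powr (- \<theta>)) * ennreal (1 / (s - u) powr (1 + \<beta>))"
      by (intro mult_right_mono bound us) auto
    also have "\<dots> = ennreal (C * s powr (- \<theta>) * ((s - u) powr \<kappa> / (s - u) powr (1 + \<beta>)))"
      using \<open>C \<ge> 0\<close> by (subst ennreal_mult'[symmetric]) (auto simp: field_simps)
    also have "(s - u) powr \<kappa> / (s - u) powr (1 + \<beta>) = (s - u) powr ?p"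
      by (simp add: powr_diff[symmetric] algebra_simps)
    also have "ennreal (C * s powr (- \<theta>) * (s - u) powr ?p) =
       ennreal (C * s powr (- \<theta>)) * (ennreal ((s - u) powr ?p) * indicator {0<..<s} u)"
      using True \<open>C \<ge> 0\<close> by (simp add: ennreal_mult')
    finally show ?thesis .
  qed (auto simp: F_def)
  have outer: "(\<integral>\<^sup>+\<omega>. \<integral>\<^sup>+u. F \<omega> s u \<partial>lborel \<partial>M) \<le>
      ennreal (C * T powr (\<kappa> - \<beta>) / (\<kappa> - \<beta>)) * (ennreal (s powr (- \<theta>)) * indicator {0<..<T} s)" for s
  proof (cases "s \<in> {0<..<T}")
    case True
    have "(\<integral>\<^sup>+\<omega>. \<integral>\<^sup>+u. F \<omega> s u \<partial>lborel \<partial>M) = (\<integral>\<^sup>+u. \<integral>\<^sup>+\<omega>. F \<omega> s u \<partial>M \<partial>lborel)"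
      by (rule P.Fubini'[symmetric]) measurable
    also have "\<dots> \<le> (\<integral>\<^sup>+u. ennreal (C * s powr (- \<theta>)) * (ennreal ((s - u) powr ?p) * indicator {0<..<s} u) \<partial>lborel)"
      by (intro nn_integral_mono inner True)
    also have "\<dots> = ennreal (C * s powr (- \<theta>)) * (\<integral>\<^sup>+u\<in>{0<..<s}. ennreal ((s - u) powr ?p) \<partial>lborel)"
      by (rule nn_integral_cmult) measurable
    also have "(\<integral>\<^sup>+u\<in>{0<..<s}. ennreal ((s - u) powr ?p) \<partial>lborel) = ennreal (s powr (\<kappa> - \<beta>) / (\<kappa> - \<beta>))"
      using nn_integral_powr_from_right[of ?p s] True \<open>\<beta> < \<kappa>\<close> by simp
    also have "\<dots> \<le> ennreal (T powr (\<kappa> - \<beta>) / (\<kappa> - \<beta>))"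
      using True \<open>\<beta> < \<kappa>\<close> by (intro ennreal_leI divide_right_mono powr_mono2) auto
    finally have "(\<integral>\<^sup>+\<omega>. \<integral>\<^sup>+u. F \<omega> s u \<partial>lborel \<partial>M) \<le>
      ennreal (C * s powr (- \<theta>)) * ennreal (T powr (\<kappa> - \<beta>) / (\<kappa> - \<beta>))" by (simp add: mult_left_mono)
    also have "\<dots> = ennreal (C * T powr (\<kappa> - \<beta>) / (\<kappa> - \<beta>)) * ennreal (s powr (- \<theta>))"
      using \<open>C \<ge> 0\<close> \<open>\<beta> < \<kappa>\<close> by (simp add: ennreal_mult'[symmetric] mult_ac)
    finally show ?thesis using True by simp
  next
    case False
    then have "F \<omega> s = (\<lambda>_. 0)" for \<omega> by (auto simp: F_def fun_eq_iff)
    then show ?thesis by simp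
  qed
  have "(\<integral>\<^sup>+\<omega>. G \<omega> \<partial>M) = (\<integral>\<^sup>+s. \<integral>\<^sup>+\<omega>. \<integral>\<^sup>+u. F \<omega> s u \<partial>lborel \<partial>M \<partial>lborel)"
    unfolding G_def by (rule P.Fubini'[symmetric]) (rule FI)
  also have "\<dots> \<le> (\<integral>\<^sup>+s. ennreal (C * T powr (\<kappa> - \<beta>) / (\<kappa> - \<beta>)) * (ennreal (s powr (- \<theta>)) * indicator {0<..<T} s) \<partial>lborel)"
    by (intro nn_integral_mono outer)
  also have "\<dots> = ennreal (C * T powr (\<kappa> - \<beta>) / (\<kappa> - \<beta>)) * (\<integral>\<^sup>+s\<in>{0<..<T}. ennreal (s powr (- \<theta>)) \<partial>lborel)"
    by (rule nn_integral_cmult) measurable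
  also have "\<dots> < \<infinity>"
    using nn_integral_powr_from_0[of "-\<theta>" T] \<open>\<theta> < 1\<close> \<open>T \<ge> 0\<close> by (simp add: ennreal_mult_less_top)
  finally have "(\<integral>\<^sup>+\<omega>. G \<omega> \<partial>M) \<noteq> \<infinity>" by simp
  moreover have "G \<in> borel_measurable M"
    unfolding G_def using lborel.borel_measurable_nn_integral_fst[OF FI] by simp
  ultimately have "AE \<omega> in M. G \<omega> \<noteq> \<infinity>" by (intro nn_integral_noteq_infinite)
  then show ?thesis by eventually_elim (simp add: G_eq less_top)
qed

end

section \<open>Processes of class X\<close>

context prob_space
begin

lemma class_X_gaussian:
  assumes X: "X \<in> class_X M T \<alpha>"
  shows "t \<in> {0..T} \<Longrightarrow> gaussian_rv M (X t)"
    and "t \<in> {0..T} \<Longrightarrow> expectation (X t) = 0"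
    and "s \<in> {0..T} \<Longrightarrow> t \<in> {0..T} \<Longrightarrow> s \<noteq> t \<Longrightarrow> gaussian_rv M (\<lambda>\<omega>. X s \<omega> - X t \<omega>)"
    and "s \<in> {0..T} \<Longrightarrow> t \<in> {0..T} \<Longrightarrow> expectation (\<lambda>\<omega>. X s \<omega> - X t \<omega>) = 0"
proof -
  have G: "finite F \<Longrightarrow> F \<subseteq> {0..T} \<Longrightarrow> gaussian_rv M (\<lambda>\<omega>. \<Sum>t\<in>F. a t * X t \<omega>)" for F a
    using X by (auto simp: class_X_def gaussian_process_def)
  show 1: "gaussian_rv M (X t)" if "t \<in> {0..T}" for t
    using G[of "{t}" "\<lambda>_. 1"] that by simp
  show 2: "expectation (X t) = 0" if "t \<in> {0..T}" for t
    using X that by (auto simp: class_X_def centered_process_def)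
  show "gaussian_rv M (\<lambda>\<omega>. X s \<omega> - X t \<omega>)" if "s \<in> {0..T}" "t \<in> {0..T}" "s \<noteq> t"
    using G[of "{s, t}" "\<lambda>r. if r = s then 1 else -1"] that by simp
  show "expectation (\<lambda>\<omega>. X s \<omega> - X t \<omega>) = 0" if "s \<in> {0..T}" "t \<in> {0..T}"
    using gaussian_rv_integrable[OF 1] 2 that by simp
qed

text \<open>
  The supremum \<open>w\<^sup>*(t)\<close> dominates the variance of every increment of lag \<open>t\<close>, and its expansion at 0
  makes it at most \<open>(C + 1) t\<^bsup>2\<alpha>\<^esup>\<close> for small \<open>t\<close>.
\<close>

lemma class_X_increment_variance:
  assumes X: "X \<in> class_X M T \<alpha>" and "T > 0"
  obtains K r0 where "K > 0" "r0 > 0"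
    "\<And>s u. 0 \<le> u \<Longrightarrow> u < s \<Longrightarrow> s \<le> T \<Longrightarrow> s - u < r0 \<Longrightarrow> incr_var M X s u \<le> K * (s - u) powr (2 * \<alpha>)"
proof -
  from X obtain C r where "C > 0" and r: "r \<in> o[at_right 0](\<lambda>t. t powr (2 * \<alpha>))"
    and w: "\<forall>\<^sub>F t in at_right 0. w_star M T X t = ereal (C * t powr (2 * \<alpha>) + r t)"
    by (auto simp: class_X_def)
  have "\<forall>\<^sub>F t in at_right 0. w_star M T X t \<le> ereal ((C + 1) * t powr (2 * \<alpha>))"
    using w landau_o.smallD[OF r, of 1, simplified]
    by eventually_elim (auto simp: algebra_simps)
  then obtain r0 where r0: "r0 > 0" "\<And>t. 0 < t \<Longrightarrow> t < r0 \<Longrightarrow> w_star M T X t \<le> ereal ((C + 1) * t powr (2 * \<alpha>))"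
    by (auto simp: eventually_at_right_field)
  show thesis
  proof (rule that[of "C + 1" r0])
    fix s u assume su: "0 \<le> u" "u < s" "s \<le> T" "s - u < r0"
    have "ereal (incr_var M X s u) \<le> w_star M T X (s - u)"
      unfolding w_star_def by (rule SUP_upper2[of u]) (use su in auto)
    also have "\<dots> \<le> ereal ((C + 1) * (s - u) powr (2 * \<alpha>))" using su by (intro r0) auto
    finally show "incr_var M X s u \<le> (C + 1) * (s - u) powr (2 * \<alpha>)" by simp
  qed (use \<open>C > 0\<close> r0 in auto)
qed

text \<open>
  This follows from \<open>x\<^sup>2 \<le> 2 y\<^sup>2 + 2 (x - y)\<^sup>2\<close>. It serves to pass to the limit
  along times at which the variances tend to 0.
\<close>

lemma class_X_variance_le:
  assumes X: "X \<in> class_X M T \<alpha>" and st: "s \<in> {0..T}" "t \<in> {0..T}" "s \<noteq> t"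
  shows "var_fun M X s \<le> 2 * var_fun M X t + 2 * incr_var M X s t"
proof -
  note mom = centered_gaussian_even_moment(1)[where m=1, simplified]
  have int: "integrable M (\<lambda>\<omega>. (X s \<omega>)\<^sup>2)" "integrable M (\<lambda>\<omega>. (X t \<omega>)\<^sup>2)"
    "integrable M (\<lambda>\<omega>. (X s \<omega> - X t \<omega>)\<^sup>2)"
    using class_X_gaussian[OF X] st by (auto intro!: mom)
  have "var_fun M X s \<le> expectation (\<lambda>\<omega>. 2 * (X t \<omega>)\<^sup>2 + 2 * (X s \<omega> - X t \<omega>)\<^sup>2)"
    unfolding var_fun_def
  proof (rule integral_mono)
    fix \<omega>
    have "0 \<le> (X s \<omega> - 2 * X t \<omega>)\<^sup>2" by simp
    then show "(X s \<omega>)\<^sup>2 \<le> 2 * (X t \<omega>)\<^sup>2 + 2 * (X s \<omega> - X t \<omega>)\<^sup>2"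
      by (simp add: power2_eq_square algebra_simps)
  qed (use int in auto)
  also have "\<dots> = 2 * var_fun M X t + 2 * incr_var M X s t"
    using int by (simp add: var_fun_def incr_var_def)
  finally show ?thesis .
qed

text \<open>
  Near 0 the bound is part of the definition of the class. Away from 0 the variance is positive, and
  it has a positive infimum by compactness: along a sequence of times on which the variances tend to
  0, a limit point would have variance 0.
\<close>

lemma class_X_variance_lower:
  assumes X: "X \<in> class_X M T \<alpha>" and "T > 0" "\<alpha> > 0"
  obtains c where "c > 0" "\<And>s. 0 < s \<Longrightarrow> s \<le> T \<Longrightarrow> c * s\<^sup>2 \<le> var_fun M X s"
proof -
  from X obtain c0 \<delta> where c0: "c0 > 0" "\<delta> > 0" "\<And>s. s \<in> {0..T} \<Longrightarrow> s \<le> \<delta> \<Longrightarrow> c0 * s\<^sup>2 \<le> var_fun M X s"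
    by (auto simp: class_X_def)
  have pos: "var_fun M X s > 0" if "s \<in> {0<..T}" for s
    using X that by (auto simp: class_X_def cov_fun_def var_fun_def power2_eq_square)
  obtain K r0 where K: "K > 0" "r0 > 0"
    "\<And>s u. 0 \<le> u \<Longrightarrow> u < s \<Longrightarrow> s \<le> T \<Longrightarrow> s - u < r0 \<Longrightarrow> incr_var M X s u \<le> K * (s - u) powr (2 * \<alpha>)"
    using class_X_increment_variance[OF X \<open>T > 0\<close>] by blast
  have W: "incr_var M X s u \<le> K * \<bar>s - u\<bar> powr (2 * \<alpha>)" if "s \<in> {0..T}" "u \<in> {0..T}" "\<bar>s - u\<bar> < r0" for s u
  proof (cases s u rule: linorder_cases)
    case less
    have "incr_var M X s u = incr_var M X u s" by (simp add: incr_var_def power2_commute)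
    with K(3)[of s u] less that show ?thesis by simp
  qed (use K(3)[of u s] that in \<open>auto simp: incr_var_def\<close>)
  have "\<exists>v>0. \<forall>s\<in>{\<delta>..T}. v \<le> var_fun M X s"
  proof (rule ccontr)
    assume no: "\<not> ?thesis"
    have "\<exists>s\<in>{\<delta>..T}. var_fun M X s < inverse (real (Suc n))" for n
      using no by (metis inverse_positive_iff_positive linorder_not_le of_nat_0_less_iff zero_less_Suc)
    then obtain x where x: "\<And>n. x n \<in> {\<delta>..T}" "\<And>n. var_fun M X (x n) < inverse (real (Suc n))" by metis
    have "seq_compact {\<delta>..T}" by (simp add: compact_imp_seq_compact)
    then obtain l \<rho> where l: "l \<in> {\<delta>..T}" and \<rho>: "strict_mono \<rho>" "(x \<circ> \<rho>) \<longlonglongrightarrow> l"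
      using x(1) by (elim seq_compactE[of _ x]) auto
    have lim: "(\<lambda>n. \<bar>l - x (\<rho> n)\<bar>) \<longlonglongrightarrow> 0"
      using tendsto_diff[OF tendsto_const \<rho>(2), of l] tendsto_rabs_zero by (auto simp: o_def)
    have "(\<lambda>n. 2 * inverse (real (Suc n)) + 2 * (K * \<bar>l - x (\<rho> n)\<bar> powr (2 * \<alpha>))) \<longlonglongrightarrow> 2 * 0 + 2 * (K * 0 powr (2 * \<alpha>))"
      using \<open>\<alpha> > 0\<close>
      by (intro tendsto_intros LIMSEQ_inverse_real_of_nat tendsto_powr2[OF lim]) auto
    then have lim0: "(\<lambda>n. 2 * inverse (real (Suc n)) + 2 * (K * \<bar>l - x (\<rho> n)\<bar> powr (2 * \<alpha>))) \<longlonglongrightarrow> 0"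
      using \<open>\<alpha> > 0\<close> by simp
    have "\<forall>\<^sub>F n in sequentially. \<bar>l - x (\<rho> n)\<bar> < r0" using lim K(2) by (rule order_tendstoD(2))
    then have ev: "\<forall>\<^sub>F n in sequentially. var_fun M X l \<le> 2 * inverse (real (Suc n)) + 2 * (K * \<bar>l - x (\<rho> n)\<bar> powr (2 * \<alpha>))"
    proof eventually_elim
      case (elim n)
      have mem: "l \<in> {0..T}" "x (\<rho> n) \<in> {0..T}" using l x(1)[of "\<rho> n"] c0(2) by auto
      have "var_fun M X (x (\<rho> n)) \<le> inverse (real (Suc n))"
        using x(2)[of "\<rho> n"] seq_suble[OF \<rho>(1), of n]
        by (smt (verit) le_imp_inverse_le of_nat_0_less_iff of_nat_mono Suc_le_mono zero_less_Suc)
      moreover have "var_fun M X l \<le> 2 * var_fun M X (x (\<rho> n)) + 2 * incr_var M X l (x (\<rho> n))"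
      proof (cases "l = x (\<rho> n)")
        case True
        have "var_fun M X l \<ge> 0" by (simp add: var_fun_def)
        with True show ?thesis by (simp add: incr_var_def)
      qed (use class_X_variance_le[OF X] mem in auto)
      moreover have "incr_var M X l (x (\<rho> n)) \<le> K * \<bar>l - x (\<rho> n)\<bar> powr (2 * \<alpha>)" by (rule W) (use mem elim in auto)
      ultimately show ?case by linarith
    qed
    have "var_fun M X l \<le> 0" using tendsto_lowerbound[OF lim0 ev] by simp
    with pos[of l] l c0(2) show False by auto
  qed
  then obtain v where v: "v > 0" "\<And>s. s \<in> {\<delta>..T} \<Longrightarrow> v \<le> var_fun M X s" by blast
  show thesis
  proof (rule that[of "min c0 (v / T\<^sup>2)"])
    fix s assume s: "0 < s" "s \<le> T"
    show "min c0 (v / T\<^sup>2) * s\<^sup>2 \<le> var_fun M X s"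
    proof (cases "s \<le> \<delta>")
      case True
      have "min c0 (v / T\<^sup>2) * s\<^sup>2 \<le> c0 * s\<^sup>2" by (intro mult_right_mono) auto
      also have "\<dots> \<le> var_fun M X s" using c0(3)[of s] s True by simp
      finally show ?thesis .
    next
      case False
      have "min c0 (v / T\<^sup>2) * s\<^sup>2 \<le> v / T\<^sup>2 * T\<^sup>2" using s v(1) by (intro mult_mono power_mono) auto
      with v(2)[of s] s False \<open>T > 0\<close> show ?thesis by simp
    qed
  qed (use c0 v \<open>T > 0\<close> in auto)
qed

text \<open>
  At lag \<open>r = s - u\<close> the scale \<open>\<delta> = r\<^sup>\<gamma>\<close> gives the bound \<open>C r\<^sup>\<gamma> / s\<close>, for small \<open>r\<close> because, up to a
  constant, \<open>r\<^sup>\<gamma>\<close> exceeds the standard deviation of the increment by a factor \<open>r\<^bsup>\<gamma>-\<alpha>\<^esup>\<close>, and a sufficiently high moment turns this factor into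
  any desired power of \<open>r\<close>. Together with the bound by the oscillation of \<open>\<phi>\<close> this yields, up to a constant,
  the minimum of \<open>y = r\<^sup>\<gamma> / s\<close> and 1, which is at most \<open>y\<^sup>\<theta>\<close>.
\<close>

lemma class_X_expected_increment:
  fixes \<phi> :: "real \<Rightarrow> real"
  assumes X: "X \<in> class_X M T \<alpha>" and "T > 0" and \<gamma>: "0 < \<gamma>" "\<gamma> < \<alpha>" and \<theta>: "0 \<le> \<theta>" "\<theta> \<le> 1"
    and \<phi>: "mono \<phi>" "\<And>x. x \<le> -N \<Longrightarrow> \<phi> x = a" "\<And>x. x \<ge> N \<Longrightarrow> \<phi> x = b" and "N \<ge> 0"
  obtains C where "C \<ge> 0" "\<And>u s. 0 < u \<Longrightarrow> u < s \<Longrightarrow> s \<le> T \<Longrightarrow>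
    (\<integral>\<^sup>+\<omega>. ennreal \<bar>\<phi> (X u \<omega>) - \<phi> (X s \<omega>)\<bar> \<partial>M) \<le> ennreal (C * (s - u) powr (\<gamma> * \<theta>) * s powr (- \<theta>))"
proof -
  obtain K r0 where K: "K > 0" "r0 > 0"
    "\<And>s u. 0 \<le> u \<Longrightarrow> u < s \<Longrightarrow> s \<le> T \<Longrightarrow> s - u < r0 \<Longrightarrow> incr_var M X s u \<le> K * (s - u) powr (2 * \<alpha>)"
    using class_X_increment_variance[OF X \<open>T > 0\<close>] by blast
  obtain c where c: "c > 0" "\<And>s. 0 < s \<Longrightarrow> s \<le> T \<Longrightarrow> c * s\<^sup>2 \<le> var_fun M X s"
    using class_X_variance_lower[OF X \<open>T > 0\<close> less_trans[OF \<gamma>]] by blast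
  note range = mono_constant_tails_bounds[of \<phi> N a b, OF \<phi>]
  then have "a \<le> b" by (meson order_trans)
  \<comment> \<open>The moment of order \<open>2m\<close> gains the factor \<open>r\<^bsup>2m(\<alpha>-\<gamma>)\<^esup>\<close>, which has to be at most \<open>r\<^sup>\<gamma>\<close>.\<close>
  obtain m :: nat where m: "\<gamma> / (2 * (\<alpha> - \<gamma>)) \<le> real m" using real_arch_simple by blast
  then have m: "\<gamma> \<le> 2 * real m * (\<alpha> - \<gamma>)" using \<gamma> by (simp add: field_simps)
  \<comment> \<open>Lags of at least \<open>r1\<close> are covered by the constant bound; lags below 1 have smaller powers for larger exponents.\<close>
  define r1 where "r1 = min r0 1"
  define cm :: real where "cm = fact (2 * m) / (2 ^ m * fact m)"
  have "cm \<ge> 0" by (simp add: cm_def)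
  define L where "L = 2 / sqrt c + cm * K ^ m * T"
  define C where "C = (b - a) * (L + T / r1 powr \<gamma> + 1)"
  have "L \<ge> 0" using c K \<open>cm \<ge> 0\<close> \<open>T > 0\<close> by (simp add: L_def)
  have "r1 > 0" "r1 \<le> 1" using K by (auto simp: r1_def)
  have C: "C \<ge> 0" "(b - a) * L \<le> C" "(b - a) * (T / r1 powr \<gamma>) \<le> C" "b - a \<le> C"
    using \<open>a \<le> b\<close> \<open>L \<ge> 0\<close> \<open>T > 0\<close> by (simp_all add: C_def distrib_left)
  show thesis
  proof (rule that[OF C(1)])
    fix u s assume us: "0 < u" "u < s" "s \<le> T"
    define r where "r = s - u"
    have "r > 0" using us by (simp add: r_def)
    let ?E = "\<integral>\<^sup>+\<omega>. ennreal \<bar>\<phi> (X u \<omega>) - \<phi> (X s \<omega>)\<bar> \<partial>M"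
    have triv: "?E \<le> ennreal (b - a)"
    proof -
      have "?E \<le> (\<integral>\<^sup>+\<omega>. ennreal (b - a) \<partial>M)"
      proof (intro nn_integral_mono ennreal_leI)
        fix \<omega> show "\<bar>\<phi> (X u \<omega>) - \<phi> (X s \<omega>)\<bar> \<le> b - a"
          using range[of "X u \<omega>"] range[of "X s \<omega>"] by auto
      qed
      then show ?thesis by (simp add: emeasure_space_1)
    qed
    have lin: "?E \<le> ennreal (C * (r powr \<gamma> / s))"
    proof (cases "r < r1")
      case True
      have mem: "s \<in> {0..T}" "u \<in> {0..T}" "s \<noteq> u" using us by auto
      note G = class_X_gaussian[OF X]
      have V: "var_fun M X s > 0" using c(2)[of s] c(1) us by (smt (verit) mult_pos_pos zero_less_power)
      obtain \<sigma> where \<sigma>: "\<sigma> > 0" "distributed M lborel (X s) (\<lambda>x. ennreal (normal_density 0 \<sigma> x))"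
        using G(1)[OF mem(1)] G(2)[OF mem(1)]
      proof (cases rule: centered_gaussian_cases)
        case 1
        have [measurable]: "X s \<in> borel_measurable M" using G(1)[OF mem(1)] by (simp add: gaussian_rv_def)
        have "var_fun M X s = expectation (\<lambda>_. 0)"
          unfolding var_fun_def by (rule integral_cong_AE) (use 1 in auto)
        with V show ?thesis by simp
      qed blast
      have "var_fun M X s = \<sigma>\<^sup>2"
        using normal_distributed_variance[OF \<sigma>] G(2)[OF mem(1)] by (simp add: var_fun_def)
      then have "(sqrt c * s)\<^sup>2 \<le> \<sigma>\<^sup>2" using c(1) c(2)[of s] us by (simp add: power_mult_distrib)
      then have \<sigma>_lower: "sqrt c * s \<le> \<sigma>" by (rule power2_le_imp_le) (use \<sigma>(1) in simp)
      have "sqrt c * s > 0" using c(1) us by simp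
      have near: "2 * r powr \<gamma> / \<sigma> \<le> 2 / sqrt c * (r powr \<gamma> / s)"
      proof -
        have "2 * r powr \<gamma> / \<sigma> \<le> 2 * r powr \<gamma> / (sqrt c * s)"
          using \<sigma>_lower \<open>sqrt c * s > 0\<close> \<sigma>(1) by (intro divide_left_mono) auto
        then show ?thesis by simp
      qed
      have "incr_var M X s u \<le> K * r powr (2 * \<alpha>)"
        unfolding r_def by (rule K(3)) (use us True in \<open>auto simp: r_def r1_def\<close>)
      then have "incr_var M X s u ^ m \<le> (K * r powr (2 * \<alpha>)) ^ m"
        by (intro power_mono) (auto simp: incr_var_def)
      also have "\<dots> = K ^ m * r powr (2 * real m * \<alpha>)"
        using \<open>r > 0\<close> by (simp add: power_mult_distrib powr_powr powr_realpow[symmetric] mult_ac)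
      finally have "incr_var M X s u ^ m / (r powr \<gamma>) ^ (2 * m) \<le> K ^ m * r powr (2 * real m * \<alpha>) / r powr (2 * real m * \<gamma>)"
        using \<open>r > 0\<close> K(1) by (intro frac_le) (auto simp: powr_powr powr_realpow[symmetric] mult_ac)
      also have "\<dots> = K ^ m * r powr (2 * real m * (\<alpha> - \<gamma>))"
        by (simp add: powr_diff right_diff_distrib)
      also have "\<dots> \<le> K ^ m * r powr \<gamma>"
        using m True \<open>r1 \<le> 1\<close> \<open>r > 0\<close> K(1) by (intro mult_left_mono powr_mono') auto
      also have "\<dots> \<le> K ^ m * (T * (r powr \<gamma> / s))"
        using us K(1) by (intro mult_left_mono) (auto simp: field_simps intro: mult_right_mono)
      finally have far': "incr_var M X s u ^ m / (r powr \<gamma>) ^ (2 * m) \<le> K ^ m * (T * (r powr \<gamma> / s))" .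
      have far: "cm * incr_var M X s u ^ m / (r powr \<gamma>) ^ (2 * m) \<le> cm * K ^ m * T * (r powr \<gamma> / s)"
        using mult_left_mono[OF far' \<open>cm \<ge> 0\<close>] by (simp add: mult.assoc)
      have "?E = (\<integral>\<^sup>+\<omega>. ennreal \<bar>\<phi> (X s \<omega>) - \<phi> (X u \<omega>)\<bar> \<partial>M)" by (simp add: abs_minus_commute)
      also have "\<dots> \<le> ennreal ((b - a) * (2 * r powr \<gamma> / \<sigma> + cm * incr_var M X s u ^ m / (r powr \<gamma>) ^ (2 * m)))"
        unfolding cm_def incr_var_def
        by (rule expectation_mono_increment_le[OF \<phi> \<open>N \<ge> 0\<close> \<sigma> G(3)[OF mem] G(4)[OF mem(1,2)]])
           (use \<open>r > 0\<close> in simp_all)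
      also have "\<dots> \<le> ennreal ((b - a) * (2 / sqrt c * (r powr \<gamma> / s) + cm * K ^ m * T * (r powr \<gamma> / s)))"
        using \<open>a \<le> b\<close> by (intro ennreal_leI mult_left_mono add_mono near far) auto
      also have "\<dots> = ennreal ((b - a) * L * (r powr \<gamma> / s))" by (simp only: L_def distrib_left distrib_right mult.assoc)
      also have "\<dots> \<le> ennreal (C * (r powr \<gamma> / s))" using C(2) us by (intro ennreal_leI mult_right_mono) auto
      finally show ?thesis .
    next
      case False
      have "1 \<le> (r / r1) powr \<gamma>" using False \<open>r1 > 0\<close> \<gamma> by (intro ge_one_powr_ge_zero) auto
      also have "\<dots> = r powr \<gamma> / r1 powr \<gamma>" using \<open>r > 0\<close> \<open>r1 > 0\<close> by (simp add: powr_divide)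
      finally have one: "1 \<le> r powr \<gamma> / r1 powr \<gamma>" .
      have "1 * 1 \<le> r powr \<gamma> / r1 powr \<gamma> * (T / s)" using one us by (intro mult_mono) auto
      then have "(b - a) * 1 \<le> (b - a) * (r powr \<gamma> / r1 powr \<gamma> * (T / s))"
        using \<open>a \<le> b\<close> by (intro mult_left_mono) auto
      also have "\<dots> = (b - a) * (T / r1 powr \<gamma>) * (r powr \<gamma> / s)" by simp
      also have "\<dots> \<le> C * (r powr \<gamma> / s)" using C(3) us by (intro mult_right_mono) auto
      finally have "b - a \<le> C * (r powr \<gamma> / s)" by simp
      then show ?thesis by (intro order_trans[OF triv] ennreal_leI)
    qed
    define y where "y = r powr \<gamma> / s"
    have "y > 0" using us \<open>r > 0\<close> by (simp add: y_def)
    have "?E \<le> ennreal (C * y powr \<theta>)"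
    proof (cases "y \<le> 1")
      case True
      then have "y powr 1 \<le> y powr \<theta>" using \<theta> \<open>y > 0\<close> by (intro powr_mono') auto
      then have "C * y \<le> C * y powr \<theta>" using C(1) \<open>y > 0\<close> by (intro mult_left_mono) auto
      then show ?thesis using \<open>y > 0\<close> by (intro order_trans[OF lin[folded y_def]] ennreal_leI) simp
    next
      case False
      then have "1 \<le> y powr \<theta>" using \<theta> by (intro ge_one_powr_ge_zero) auto
      then have "C * 1 \<le> C * y powr \<theta>" using C(1) by (intro mult_left_mono) auto
      with C(4) have "b - a \<le> C * y powr \<theta>" by simp
      then show ?thesis by (intro order_trans[OF triv] ennreal_leI)
    qed
    also have "C * y powr \<theta> = C * (s - u) powr (\<gamma> * \<theta>) * s powr (- \<theta>)"
      using us \<open>r > 0\<close> by (simp add: y_def r_def powr_divide powr_powr powr_minus divide_simps)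
    finally show "?E \<le> ennreal (C * (s - u) powr (\<gamma> * \<theta>) * s powr (- \<theta>))" .
  qed
qed

section \<open>Left derivatives along the paths\<close>

text \<open>
  The functions \<open>\<phi> i\<close> are composed with the clamping of the line to \<open>[-N, N]\<close>, for every natural number
  \<open>N\<close>. Almost surely all the resulting double integrals are finite, and since a continuous path is
  bounded, clamping at some \<open>N\<close> that depends on the path does not change it.
\<close>

lemma class_X_AE_besov2:
  fixes \<phi> :: "nat \<Rightarrow> real \<Rightarrow> real"
  assumes X: "X \<in> class_X M T \<alpha>" and "T > 0" and \<beta>: "0 < \<beta>" "\<beta> < \<alpha>" "\<beta> < 1"
    and \<phi>: "\<And>i. mono (\<phi> i)" and h: "h = (\<lambda>x. \<Sum>i<n. k i * \<phi> i x)"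
  shows "AE \<omega> in M. (\<lambda>t. h (X t \<omega>)) \<in> besov2 T \<beta>"
proof -
  have \<phi>_meas[measurable]: "\<phi> i \<in> borel_measurable borel" for i using \<phi> by (rule borel_measurable_mono)
  have h_meas[measurable]: "h \<in> borel_measurable borel" unfolding h by measurable
  have X_meas: "X t \<in> borel_measurable M" if "t \<in> {0..T}" for t
    using class_X_gaussian(1)[OF X that] by (simp add: gaussian_rv_def)
  have cont: "continuous_process M T X" using X by (simp add: class_X_def)
  obtain Z where Z: "(\<lambda>(\<omega>, t). Z t \<omega>) \<in> borel_measurable (M \<Otimes>\<^sub>M borel)"
    and ZX: "AE \<omega> in M. \<forall>t\<in>{0..T}. Z t \<omega> = X t \<omega>"
    by (rule continuous_process_jointly_measurable_version[OF less_imp_le[OF \<open>T > 0\<close>] X_meas cont])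
  define clamp :: "nat \<Rightarrow> real \<Rightarrow> real" where "clamp N x = max (- real N) (min (real N) x)" for N x
  have [measurable]: "clamp N \<in> borel_measurable borel" for N unfolding clamp_def by measurable
  \<comment> \<open>The value of \<open>\<theta>\<close> makes \<open>\<gamma>\<theta>\<close> the midpoint of \<open>\<beta>\<close> and \<open>\<gamma>\<close>.\<close>
  define \<gamma> where "\<gamma> = (\<alpha> + \<beta>) / 2"
  define \<theta> where "\<theta> = (\<gamma> + \<beta>) / (2 * \<gamma>)"
  have \<gamma>: "0 < \<gamma>" "\<gamma> < \<alpha>" "\<beta> < \<gamma>" using \<beta> by (auto simp: \<gamma>_def)
  have \<theta>: "0 \<le> \<theta>" "\<theta> < 1" using \<gamma> \<beta> by (auto simp: \<theta>_def)
  have \<gamma>\<theta>: "\<gamma> * \<theta> = (\<gamma> + \<beta>) / 2" using \<gamma> by (simp add: \<theta>_def)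
  have fin: "AE \<omega> in M. (\<integral>\<^sup>+s\<in>{0<..<T}. (\<integral>\<^sup>+u\<in>{0<..<s}.
      ennreal (\<bar>h (clamp N (Z u \<omega>)) - h (clamp N (Z s \<omega>))\<bar> / (s - u) powr (1 + \<beta>)) \<partial>lborel) \<partial>lborel) < \<infinity>" for N
  proof -
    define P where "P i C \<longleftrightarrow> C \<ge> 0 \<and> (\<forall>u s. 0 < u \<longrightarrow> u < s \<longrightarrow> s \<le> T \<longrightarrow>
      (\<integral>\<^sup>+\<omega>. ennreal \<bar>\<phi> i (clamp N (X u \<omega>)) - \<phi> i (clamp N (X s \<omega>))\<bar> \<partial>M)
        \<le> ennreal (C * (s - u) powr (\<gamma> * \<theta>) * s powr (- \<theta>)))" for i C
    have "\<exists>C. P i C" for i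
    proof -
      have "mono (\<lambda>x. \<phi> i (clamp N x))"
        by (intro monoI monoD[OF \<phi>]) (auto simp: clamp_def)
      moreover have "\<phi> i (clamp N x) = \<phi> i (- real N)" if "x \<le> - real N" for x
        using that by (simp add: clamp_def)
      moreover have "\<phi> i (clamp N x) = \<phi> i (real N)" if "x \<ge> real N" for x
        using that by (simp add: clamp_def)
      ultimately show ?thesis
      proof (rule class_X_expected_increment[OF X \<open>T > 0\<close> \<gamma>(1,2) \<theta>(1) less_imp_le[OF \<theta>(2)] _ _ _ of_nat_0_le_iff])
        fix C :: real
        assume "C \<ge> 0" "\<And>u s. 0 < u \<Longrightarrow> u < s \<Longrightarrow> s \<le> T \<Longrightarrow>
          (\<integral>\<^sup>+\<omega>. ennreal \<bar>\<phi> i (clamp N (X u \<omega>)) - \<phi> i (clamp N (X s \<omega>))\<bar> \<partial>M)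
            \<le> ennreal (C * (s - u) powr (\<gamma> * \<theta>) * s powr (- \<theta>))"
        then have "P i C" by (simp add: P_def)
        then show ?thesis ..
      qed
    qed
    then obtain C where P: "\<And>i. P i (C i)" by metis
    have C: "C i \<ge> 0" "0 < u \<Longrightarrow> u < s \<Longrightarrow> s \<le> T \<Longrightarrow>
      (\<integral>\<^sup>+\<omega>. ennreal \<bar>\<phi> i (clamp N (X u \<omega>)) - \<phi> i (clamp N (X s \<omega>))\<bar> \<partial>M)
        \<le> ennreal (C i * (s - u) powr (\<gamma> * \<theta>) * s powr (- \<theta>))" for i u s
      using P[of i] by (simp_all add: P_def)
    show ?thesis
    proof (rule AE_double_integral_finite[where C="\<Sum>i<n. \<bar>k i\<bar> * C i" and \<kappa>="\<gamma> * \<theta>" and \<theta>=\<theta>])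
      show "(\<lambda>(\<omega>, t). h (clamp N (Z t \<omega>))) \<in> borel_measurable (M \<Otimes>\<^sub>M borel)"
        using measurable_compose[OF Z, of "\<lambda>x. h (clamp N x)"] by (simp add: case_prod_beta')
    next
      fix u s assume us: "0 < u" "u < s" "s < T"
      let ?d = "\<lambda>i \<omega>. \<bar>\<phi> i (clamp N (X u \<omega>)) - \<phi> i (clamp N (X s \<omega>))\<bar>"
      have [measurable]: "X u \<in> borel_measurable M" "X s \<in> borel_measurable M" using us by (auto intro: X_meas)
      have "(\<integral>\<^sup>+\<omega>. ennreal \<bar>h (clamp N (Z u \<omega>)) - h (clamp N (Z s \<omega>))\<bar> \<partial>M) \<le>
          (\<integral>\<^sup>+\<omega>. (\<Sum>i<n. ennreal \<bar>k i\<bar> * ennreal (?d i \<omega>)) \<partial>M)"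
      proof (rule nn_integral_mono_AE)
        show "AE \<omega> in M. ennreal \<bar>h (clamp N (Z u \<omega>)) - h (clamp N (Z s \<omega>))\<bar> \<le> (\<Sum>i<n. ennreal \<bar>k i\<bar> * ennreal (?d i \<omega>))"
          using ZX
        proof eventually_elim
          case (elim \<omega>)
          have "\<bar>h (clamp N (X u \<omega>)) - h (clamp N (X s \<omega>))\<bar> =
              \<bar>\<Sum>i<n. k i * (\<phi> i (clamp N (X u \<omega>)) - \<phi> i (clamp N (X s \<omega>)))\<bar>"
            by (simp add: h sum_subtractf[symmetric] right_diff_distrib)
          also have "\<dots> \<le> (\<Sum>i<n. \<bar>k i\<bar> * ?d i \<omega>)"
            by (rule order_trans[OF sum_abs]) (simp add: abs_mult)
          finally have "ennreal \<bar>h (clamp N (X u \<omega>)) - h (clamp N (X s \<omega>))\<bar> \<le> ennreal (\<Sum>i<n. \<bar>k i\<bar> * ?d i \<omega>)"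
            by (rule ennreal_leI)
          also have "\<dots> = (\<Sum>i<n. ennreal \<bar>k i\<bar> * ennreal (?d i \<omega>))"
            by (simp add: sum_ennreal[symmetric] ennreal_mult' del: sum_ennreal)
          finally show ?case using elim us by simp
        qed
      qed
      also have "\<dots> = (\<Sum>i<n. ennreal \<bar>k i\<bar> * (\<integral>\<^sup>+\<omega>. ennreal (?d i \<omega>) \<partial>M))"
        by (subst nn_integral_sum) (auto intro!: sum.cong nn_integral_cmult)
      also have "\<dots> \<le> (\<Sum>i<n. ennreal \<bar>k i\<bar> * ennreal (C i * (s - u) powr (\<gamma> * \<theta>) * s powr (- \<theta>)))"
        using us by (intro sum_mono mult_left_mono C(2)) auto
      also have "\<dots> = ennreal (\<Sum>i<n. \<bar>k i\<bar> * (C i * (s - u) powr (\<gamma> * \<theta>) * s powr (- \<theta>)))"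
        using C(1) by (simp add: sum_ennreal[symmetric] ennreal_mult' del: sum_ennreal)
      also have "(\<Sum>i<n. \<bar>k i\<bar> * (C i * (s - u) powr (\<gamma> * \<theta>) * s powr (- \<theta>))) =
          (\<Sum>i<n. \<bar>k i\<bar> * C i) * (s - u) powr (\<gamma> * \<theta>) * s powr (- \<theta>)"
        by (simp add: sum_distrib_right mult.assoc)
      finally show "(\<integral>\<^sup>+\<omega>. ennreal \<bar>h (clamp N (Z u \<omega>)) - h (clamp N (Z s \<omega>))\<bar> \<partial>M) \<le>
          ennreal ((\<Sum>i<n. \<bar>k i\<bar> * C i) * (s - u) powr (\<gamma> * \<theta>) * s powr (- \<theta>))" .
    next
      show "0 \<le> (\<Sum>i<n. \<bar>k i\<bar> * C i)" using C(1) by (intro sum_nonneg mult_nonneg_nonneg) auto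
      show "\<beta> < \<gamma> * \<theta>" using \<gamma> by (simp add: \<gamma>\<theta>)
    qed (use \<theta> \<open>T > 0\<close> in auto)
  qed
  have "AE \<omega> in M. \<forall>N. (\<integral>\<^sup>+s\<in>{0<..<T}. (\<integral>\<^sup>+u\<in>{0<..<s}.
      ennreal (\<bar>h (clamp N (Z u \<omega>)) - h (clamp N (Z s \<omega>))\<bar> / (s - u) powr (1 + \<beta>)) \<partial>lborel) \<partial>lborel) < \<infinity>"
    by (intro AE_all_countable[THEN iffD2] allI fin)
  moreover have "AE \<omega> in M. continuous_on {0..T} (\<lambda>t. X t \<omega>)" using cont by (simp add: continuous_process_def)
  ultimately show ?thesis using ZX
  proof eventually_elim
    case (elim \<omega>)
    have "compact ((\<lambda>t. X t \<omega>) ` {0..T})" using elim(2) by (intro compact_continuous_image) auto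
    then have "bounded ((\<lambda>t. X t \<omega>) ` {0..T})" by (rule compact_imp_bounded)
    then obtain B where B: "\<forall>t\<in>{0..T}. \<bar>X t \<omega>\<bar> \<le> B"
      by (auto simp: bounded_iff)
    obtain N :: nat where "B \<le> real N" using real_arch_simple by blast
    have XN: "\<bar>X t \<omega>\<bar> \<le> real N" if "t \<in> {0..T}" for t
      using bspec[OF B that] \<open>B \<le> real N\<close> by simp
    have cl: "clamp N (Z t \<omega>) = X t \<omega>" if "t \<in> {0..T}" for t
      using XN[OF that] elim(3) that by (auto simp: clamp_def)
    have "(\<lambda>t. h (X t \<omega>)) \<in> borel_measurable (restrict_space borel {0..T})"
      using borel_measurable_continuous_on_restrict[OF elim(2)] by measurable
    moreover have "(\<integral>\<^sup>+s\<in>{0<..<T}. ennreal (\<bar>h (X s \<omega>)\<bar> / s powr \<beta>) \<partial>lborel) < \<infinity>"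
    proof -
      define H where "H = (\<Sum>i<n. \<bar>k i\<bar> * (\<bar>\<phi> i (real N)\<bar> + \<bar>\<phi> i (- real N)\<bar>))"
      have H: "\<bar>h x\<bar> \<le> H" if "\<bar>x\<bar> \<le> real N" for x
      proof -
        have "\<bar>\<phi> i x\<bar> \<le> \<bar>\<phi> i (real N)\<bar> + \<bar>\<phi> i (- real N)\<bar>" for i
        proof -
          have "\<phi> i x \<le> \<phi> i (real N)" "\<phi> i (- real N) \<le> \<phi> i x"
            using that by (intro monoD[OF \<phi>]; simp)+
          then show ?thesis by linarith
        qed
        then have "(\<Sum>i<n. \<bar>k i * \<phi> i x\<bar>) \<le> H"
          unfolding H_def abs_mult by (intro sum_mono mult_left_mono) simp_all
        then show ?thesis unfolding h by (rule order_trans[OF sum_abs])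
      qed
      have "H \<ge> 0" unfolding H_def by (intro sum_nonneg) auto
      have "(\<integral>\<^sup>+s\<in>{0<..<T}. ennreal (\<bar>h (X s \<omega>)\<bar> / s powr \<beta>) \<partial>lborel) \<le>
        (\<integral>\<^sup>+s. ennreal H * (ennreal (s powr (- \<beta>)) * indicator {0<..<T} s) \<partial>lborel)"
      proof (rule nn_integral_mono)
        fix s
        show "ennreal (\<bar>h (X s \<omega>)\<bar> / s powr \<beta>) * indicator {0<..<T} s \<le> ennreal H * (ennreal (s powr (- \<beta>)) * indicator {0<..<T} s)"
        proof (cases "s \<in> {0<..<T}")
          case True
          then have "\<bar>h (X s \<omega>)\<bar> / s powr \<beta> \<le> H * s powr (- \<beta>)"
            using H[OF XN[of s]] by (simp add: powr_minus divide_inverse mult_right_mono)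
          with True \<open>H \<ge> 0\<close> show ?thesis by (simp add: ennreal_mult[symmetric] ennreal_leI)
        qed simp
      qed
      also have "\<dots> = ennreal H * (\<integral>\<^sup>+s\<in>{0<..<T}. ennreal (s powr (- \<beta>)) \<partial>lborel)"
        by (rule nn_integral_cmult) measurable
      also have "\<dots> < \<infinity>"
        using nn_integral_powr_from_0[of "-\<beta>" T] \<beta> \<open>T > 0\<close> by (simp add: ennreal_mult_less_top)
      finally show ?thesis .
    qed
    moreover have "(\<integral>\<^sup>+s\<in>{0<..<T}. (\<integral>\<^sup>+u\<in>{0<..<s}.
      ennreal (\<bar>h (X u \<omega>) - h (X s \<omega>)\<bar> / (s - u) powr (1 + \<beta>)) \<partial>lborel) \<partial>lborel) < \<infinity>"
    proof -
      have "(\<integral>\<^sup>+s\<in>{0<..<T}. (\<integral>\<^sup>+u\<in>{0<..<s}.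
          ennreal (\<bar>h (X u \<omega>) - h (X s \<omega>)\<bar> / (s - u) powr (1 + \<beta>)) \<partial>lborel) \<partial>lborel) =
        (\<integral>\<^sup>+s\<in>{0<..<T}. (\<integral>\<^sup>+u\<in>{0<..<s}.
          ennreal (\<bar>h (clamp N (Z u \<omega>)) - h (clamp N (Z s \<omega>))\<bar> / (s - u) powr (1 + \<beta>)) \<partial>lborel) \<partial>lborel)"
      proof (rule nn_integral_cong)
        fix s
        show "(\<integral>\<^sup>+u\<in>{0<..<s}. ennreal (\<bar>h (X u \<omega>) - h (X s \<omega>)\<bar> / (s - u) powr (1 + \<beta>)) \<partial>lborel) * indicator {0<..<T} s =
          (\<integral>\<^sup>+u\<in>{0<..<s}. ennreal (\<bar>h (clamp N (Z u \<omega>)) - h (clamp N (Z s \<omega>))\<bar> / (s - u) powr (1 + \<beta>)) \<partial>lborel)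
            * indicator {0<..<T} s"
        proof (cases "s \<in> {0<..<T}")
          case True
          then have "(\<integral>\<^sup>+u\<in>{0<..<s}. ennreal (\<bar>h (X u \<omega>) - h (X s \<omega>)\<bar> / (s - u) powr (1 + \<beta>)) \<partial>lborel) =
            (\<integral>\<^sup>+u\<in>{0<..<s}. ennreal (\<bar>h (clamp N (Z u \<omega>)) - h (clamp N (Z s \<omega>))\<bar> / (s - u) powr (1 + \<beta>)) \<partial>lborel)"
            by (intro nn_integral_cong) (auto simp: indicator_def cl)
          then show ?thesis by simp
        qed simp
      qed
      with elim(1) show ?thesis by simp
    qed
    ultimately show ?case by (simp add: besov2_def besov2_norm_def)
  qed
qed

end

theorem corollary3p1:
  fixes M :: "'a measure" and T \<alpha> \<beta> :: real
    and f :: "real \<Rightarrow> real" and X Y :: "real \<Rightarrow> 'a \<Rightarrow> real"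
  assumes "prob_space M"
    and "T > 0"
    and "lin_comb_convex f"
    and "0 < \<alpha>" and "\<alpha> < 1" and "\<alpha> > 1 / 3"
    and "X \<in> class_X M T \<alpha>"
    and "0 < \<beta>" and "\<beta> < min \<alpha> (3 * \<alpha> - 1)"
    and "\<And>t. t \<in> {0..T} \<Longrightarrow> Y t \<in> borel_measurable M"
    and "AE \<omega> in M. (\<lambda>t. Y t \<omega>) \<in> besov1 T (1 - \<beta>)"
  shows "AE \<omega> in M. \<exists>I. has_gls_integral T \<beta> T (\<lambda>u. left_deriv f (X u \<omega>)) (\<lambda>u. Y u \<omega>) I"
proof -
  interpret prob_space M by fact
  have \<beta>: "0 < \<beta>" "\<beta> < \<alpha>" "\<beta> < 1" using assms by auto
  obtain n :: nat and k and \<phi> :: "nat \<Rightarrow> real \<Rightarrow> real"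
    where \<phi>: "\<And>i. mono (\<phi> i)" "left_deriv f = (\<lambda>x. \<Sum>i<n. k i * \<phi> i x)"
    by (rule lin_comb_convex_left_deriv[OF \<open>lin_comb_convex f\<close>]) (rule that)
  have "AE \<omega> in M. (\<lambda>t. left_deriv f (X t \<omega>)) \<in> besov2 T \<beta>"
    by (rule class_X_AE_besov2[OF \<open>X \<in> class_X M T \<alpha>\<close> \<open>T > 0\<close> \<beta> \<phi>])
  then show ?thesis
    using \<open>AE \<omega> in M. (\<lambda>t. Y t \<omega>) \<in> besov1 T (1 - \<beta>)\<close>
    by eventually_elim (rule gls_integral_exists[OF _ _ \<beta>(1,3) \<open>T > 0\<close>])
qed

end
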